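(* Let $n,m$ be positive integers with $n\geq 2m+2$, and let $\mathcal{G}=\{G_1,G_2,\ldots,G_{m+1}\}$ be a family of graphs on the common vertex set $[n]=\{1,\ldots,n\}$. Suppose that for every $i\in[m+1]$, \[ \rho(G_i)\geq\max\Big\{2m,\ \tfrac{1}{2}\big(m-1+\sqrt{(m-1)^2+4m(n-m)}\big)\Big\}. \] Then: (1) if $2m+2\leq n<3m+2$, $\mathcal{G}$ admits a rainbow matching unless $G_1=\cdots=G_{m+1}\simeq A^1_{n,m}$; (2) if $n=3m+2$, $\mathcal{G}$ admits a rainbow matching unless $G_1=\cdots=G_{m+1}\simeq A^{m+1}_{n,m}$ or $G_1=\cdots=G_{m+1}\simeq A^1_{n,m}$; (3) if $n>3m+2$, $\mathcal{G}$ admits a rainbow matching unless $G_1=\cdots=G_{m+1}\simeq A^{m+1}_{n,m}$.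
   Context: $\rho(G)$ denotes the spectral radius (largest adjacency eigenvalue) of a graph $G$. A rainbow matching for a family $\{G_1,\ldots,G_t\}$ of graphs on the same vertex set is a set of $t$ pairwise disjoint edges $e_1,\ldots,e_t$ with $e_i\in E(G_i)$ for each $i$. $G=H$ means same vertex set and same edge set; $G\simeq H$ means isomorphic. For $1\leq i\leq m+1$, $A^i_{n,m}$ is the graph on $[n]$ whose edges are all pairs having at least one endpoint in $[i-1]$ together with all pairs contained in $[2m-i+2]\setminus[i-1]$ (i.e. $K_{i-1}\vee(K_{2m-2i+3}\cup \overline{K_{n-2m+i-2}})$, where $[0]=\emptyset$). Thus $A^1_{n,m}=K_{2m+1}\cup(n-2m-1)K_1$ and $A^{m+1}_{n,m}=K_m\vee (n-m)K_1$. *)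

theory Defs
  imports Complex_Main "Jordan_Normal_Form.Char_Poly"
begin

text \<open>
  A simple graph on the vertex set $[n] = \{1, \dots, n\}$ is represented by its edge set, a set of
  two-element subsets of \<open>{1..n}\<close>; since the vertex set is fixed, equality of graphs is
  equality of edge sets.
\<close>

definition all_pairs :: "nat \<Rightarrow> nat set set" where
  "all_pairs n = {e. e \<subseteq> {1..n} \<and> card e = 2}"

definition graph_on :: "nat \<Rightarrow> nat set set \<Rightarrow> bool" where
  "graph_on n E \<longleftrightarrow> E \<subseteq> all_pairs n"

text \<open>Matrix indices start at 0, so vertex \<open>v\<close> has index \<open>v - 1\<close>.\<close>

definition adjacency_matrix :: "nat \<Rightarrow> nat set set \<Rightarrow> real mat" where
  "adjacency_matrix n E = mat n n (\<lambda>(u, v). if {u + 1, v + 1} \<in> E then 1 else 0)"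

definition graph_spectral_radius :: "nat \<Rightarrow> nat set set \<Rightarrow> real" where
  "graph_spectral_radius n E = Max {k. eigenvalue (adjacency_matrix n E) k}"

definition graph_isomorphic :: "nat \<Rightarrow> nat set set \<Rightarrow> nat set set \<Rightarrow> bool" where
  "graph_isomorphic n E F \<longleftrightarrow>
     (\<exists>f. bij_betw f {1..n} {1..n} \<and>
        (\<forall>u\<in>{1..n}. \<forall>v\<in>{1..n}. {u, v} \<in> E \<longleftrightarrow> {f u, f v} \<in> F))"

definition has_rainbow_matching :: "nat \<Rightarrow> (nat \<Rightarrow> nat set set) \<Rightarrow> bool" where
  "has_rainbow_matching t G \<longleftrightarrow>
     (\<exists>e. (\<forall>i\<in>{1..t}. e i \<in> G i) \<and>
        (\<forall>i\<in>{1..t}. \<forall>j\<in>{1..t}. i \<noteq> j \<longrightarrow> e i \<inter> e j = {}))"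

text \<open>
  The graph $A^i_{n,m}$, intended for $1 \le i \le m + 1$ (so the subtractions do not truncate).
\<close>

definition A_graph :: "nat \<Rightarrow> nat \<Rightarrow> nat \<Rightarrow> nat set set" where
  "A_graph i n m =
     {e \<in> all_pairs n. e \<inter> {1..i - 1} \<noteq> {} \<or> e \<subseteq> {1..2 * m + 2 - i} - {1..i - 1}}"

text \<open>$G_1 = \dots = G_t \simeq H$\<close>

definition all_equal_iso :: "nat \<Rightarrow> nat \<Rightarrow> (nat \<Rightarrow> nat set set) \<Rightarrow> nat set set \<Rightarrow> bool" where
  "all_equal_iso n t G H \<longleftrightarrow> (\<forall>i\<in>{1..t}. G i = G 1) \<and> graph_isomorphic n (G 1) H"

end

theory Submission
  imports Defs "Jordan_Normal_Form.Spectral_Radius" "HOL-Combinatorics.Transposition"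
begin

text \<open>
  Write \<open>b\<close> for the bound in the hypothesis. Passing to absolute values in an eigenvector, the
  hypothesis on $G_i$ gives a nonzero vector $x \ge 0$ with $x^T A x \ge b\, x^T x$, and only this is used.

  Replacing the vertex \<open>c\<close> by \<open>a\<close> in all edges for which this gives a new edge (shifting)
  preserves the existence of such vectors and creates no rainbow matching.
  If all members of a family are stable under shifting and one of them misses the edge
  $\{i, 2m+3-i\}$, then it is contained in $A^i_{n,m}$. A positive vector \<open>y\<close> with $A y \le b y$
  shows that this is impossible unless the member equals $A^1_{n,m}$ or $A^{m+1}_{n,m}$. So each
  member misses at most one of the $m+1$ disjoint edges, and these can be distributed over the
  members unless all members are the same extremal graph.

  To undo a shift that ends in an extremal graph \<open>H\<close>, one uses that the maximising vector of \<open>H\<close> is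
  known: it forces each $G_i$ to be \<open>H\<close> or \<open>H\<close> with \<open>a\<close> and \<open>c\<close> exchanged, and a family containing
  both has a rainbow matching.
\<close>

subsection \<open>Rigidity of the quadratic form\<close>

text \<open>The right-hand side is x^T A x for the adjacency matrix A, with each unordered edge
  counted once and the total doubled. Writing the form over edges lets a shift, which is an
  injective map on edges, be compared term by term.\<close>

definition spectral_certificate :: "nat \<Rightarrow> real \<Rightarrow> nat set set \<Rightarrow> (nat \<Rightarrow> real) \<Rightarrow> bool" where
  "spectral_certificate n b G x \<longleftrightarrow>
     (\<forall>u\<in>{1..n}. 0 \<le> x u) \<and> (\<exists>u\<in>{1..n}. x u \<noteq> 0) \<and>
     b * (\<Sum>u\<in>{1..n}. (x u)\<^sup>2) \<le> 2 * (\<Sum>e\<in>G. \<Prod>u\<in>e. x u)"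

definition nbhd :: "nat \<Rightarrow> nat set set \<Rightarrow> nat \<Rightarrow> nat set" where
  "nbhd n G u = {v \<in> {1..n}. {u, v} \<in> G}"

section \<open>Edges as unordered and as ordered pairs\<close>

lemma finite_all_pairs: "finite (all_pairs n)"
  unfolding all_pairs_def by (rule finite_subset[of _ "Pow {1..n}"]) auto

lemma pair_in_all_pairs: "{u, v} \<in> all_pairs n \<longleftrightarrow> u \<in> {1..n} \<and> v \<in> {1..n} \<and> u \<noteq> v"
  unfolding all_pairs_def by (auto simp: card_insert_if)

lemma all_pairs_cases:
  assumes "e \<in> all_pairs n"
  obtains u v where "e = {u, v}" "u < v" "u \<in> {1..n}" "v \<in> {1..n}"
proof -
  have e: "e \<subseteq> {1..n}" "card e = 2" using assms unfolding all_pairs_def by auto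
  then obtain u v where uv: "e = {u, v}" "u \<noteq> v" by (meson card_2_iff)
  show ?thesis
  proof (rule that[of "min u v" "max u v"])
    show "e = {min u v, max u v}" using uv(1) by (cases "u \<le> v") (auto simp: min_def max_def)
    show "min u v < max u v" using uv(2) by (simp add: min_def max_def)
    show "min u v \<in> {1..n}" "max u v \<in> {1..n}" using e(1) uv(1) by (auto simp: min_def max_def)
  qed
qed

lemma darts_eq_Sigma:
  assumes "G \<subseteq> all_pairs n"
  shows "{(u,v). {u,v} \<in> G} = (SIGMA u:{1..n}. nbhd n G u)"
proof -
  have "u \<in> {1..n} \<and> v \<in> {1..n}" if "{u,v} \<in> G" for u v
    using subsetD[OF assms that] pair_in_all_pairs by simp
  then show ?thesis unfolding nbhd_def by blast
qed

lemma sum_darts: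
  fixes f :: "nat \<Rightarrow> nat \<Rightarrow> real"
  assumes "G \<subseteq> all_pairs n"
  shows "(\<Sum>(u,v)\<in>{(u,v). {u,v} \<in> G}. f u v) = (\<Sum>u\<in>{1..n}. \<Sum>v\<in>nbhd n G u. f u v)"
proof -
  have "finite (nbhd n G u)" for u unfolding nbhd_def by simp
  then show ?thesis unfolding darts_eq_Sigma[OF assms] by (simp add: sum.Sigma)
qed

lemma finite_darts:
  assumes "G \<subseteq> all_pairs n"
  shows "finite {(u,v). {u,v} \<in> G}"
  unfolding darts_eq_Sigma[OF assms] by (simp add: nbhd_def)

text \<open>The fibre of an edge under forgetting the order consists of exactly its two
  orientations.\<close>

lemma sum_darts_edges:
  fixes h :: "nat set \<Rightarrow> real"
  assumes G: "G \<subseteq> all_pairs n"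
  shows "(\<Sum>(u,v)\<in>{(u,v). {u,v} \<in> G}. h {u,v}) = 2 * (\<Sum>e\<in>G. h e)"
proof -
  let ?D = "{(u,v). {u,v} \<in> G}"
  have fG: "finite G" using G finite_all_pairs finite_subset by blast
  have "(\<Sum>e\<in>G. \<Sum>p\<in>{p\<in>?D. (case p of (u,v) \<Rightarrow> {u,v}) = e}. (case p of (u,v) \<Rightarrow> h {u,v}))
      = (\<Sum>p\<in>?D. (case p of (u,v) \<Rightarrow> h {u,v}))"
    by (rule sum.group[OF finite_darts[OF G] fG]) auto
  moreover have "(\<Sum>p\<in>{p\<in>?D. (case p of (u,v) \<Rightarrow> {u,v}) = e}. (case p of (u,v) \<Rightarrow> h {u,v})) = 2 * h e"
    if e: "e \<in> G" for e
  proof -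
    obtain a b where ab: "e = {a, b}" "a < b" using all_pairs_cases e G by (metis subsetD)
    have ba: "{b, a} = e" using ab by auto
    have "p \<in> ?D \<and> (case p of (u,v) \<Rightarrow> {u,v}) = e \<longleftrightarrow> p = (a,b) \<or> p = (b,a)" for p
    proof (cases p)
      case (Pair u v)
      have "{u, v} = {a, b} \<longleftrightarrow> u = a \<and> v = b \<or> u = b \<and> v = a" by (rule doubleton_eq_iff)
      moreover have "{u, v} \<in> G" if "{u, v} = {a, b}" using e ab(1) that by simp
      ultimately show ?thesis using Pair unfolding ab(1) by auto
    qed
    then have "{p\<in>?D. (case p of (u,v) \<Rightarrow> {u,v}) = e} = {p. p = (a,b) \<or> p = (b,a)}"
      by (rule Collect_cong)
    also have "\<dots> = {(a,b),(b,a)}" by auto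
    finally have "{p\<in>?D. (case p of (u,v) \<Rightarrow> {u,v}) = e} = {(a,b),(b,a)}" .
    then show ?thesis using ab ba by simp
  qed
  ultimately show ?thesis by (simp add: sum_distrib_left)
qed

text \<open>Expanding squares shows that b |x|^2 minus the form of \<open>F\<close> equals
  \<open>L + R / 2\<close>. Here \<open>L\<close> collects the slack of the superharmonic vector
  \<open>y\<close>, and \<open>R\<close> is a weighted sum of squares comparing \<open>x\<close>
  with \<open>y\<close> along edges. With \<open>M\<close> the contribution of \<open>F - G\<close>,
  the certificate gives \<open>L + R / 2 + 2 * M \<le> 0\<close>, while all three are sums of
  nonnegative terms. So every term vanishes: \<open>R\<close>, \<open>L\<close> and \<open>M\<close>
  yield the first three conclusions, and \<open>L\<close> and \<open>R\<close> together the
  fourth.\<close>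

lemma certificate_rigid:
  fixes y :: "nat \<Rightarrow> real"
  assumes F: "F \<subseteq> all_pairs n" and GF: "G \<subseteq> F"
    and cert: "spectral_certificate n b G x"
    and y_pos: "\<forall>u\<in>{1..n}. 0 < y u"
    and superharmonic: "\<forall>u\<in>{1..n}. (\<Sum>v\<in>nbhd n F u. y v) \<le> b * y u"
  shows "\<And>u v. {u, v} \<in> F \<Longrightarrow> x u * y v = x v * y u"
    and "\<And>u. u \<in> {1..n} \<Longrightarrow> (\<Sum>v\<in>nbhd n F u. y v) < b * y u \<Longrightarrow> x u = 0"
    and "\<And>e. e \<in> F - G \<Longrightarrow> (\<Prod>u\<in>e. x u) = 0"
    and "2 * (\<Sum>e\<in>F. \<Prod>u\<in>e. x u) = b * (\<Sum>u\<in>{1..n}. (x u)\<^sup>2)"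
proof -
  let ?D = "{(u,v). {u,v} \<in> F}"
  have x: "\<And>u. u \<in> {1..n} \<Longrightarrow> 0 \<le> x u" and
    big: "b * (\<Sum>u\<in>{1..n}. (x u)\<^sup>2) \<le> 2 * (\<Sum>e\<in>G. \<Prod>u\<in>e. x u)"
    using cert unfolding spectral_certificate_def by auto
  note y = bspec[OF y_pos] and super = bspec[OF superharmonic]
  have fD: "finite ?D" by (rule finite_darts[OF F])
  have fF: "finite F" using F finite_all_pairs finite_subset by blast
  have inD: "u \<in> {1..n} \<and> v \<in> {1..n} \<and> u \<noteq> v" if "{u,v} \<in> F" for u v
    using that F pair_in_all_pairs by blast
  define T where "T = (\<Sum>(u,v)\<in>?D. (x u)\<^sup>2 * y v / y u)"
  define R where "R = (\<Sum>(u,v)\<in>?D. (x u * y v - x v * y u)\<^sup>2 / (y u * y v))"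
  define q where "q = (\<Sum>e\<in>F. \<Prod>u\<in>e. x u)"
  define L where "L = (\<Sum>u\<in>{1..n}. (x u)\<^sup>2 * (b - (\<Sum>v\<in>nbhd n F u. y v) / y u))"
  define M where "M = (\<Sum>e\<in>F - G. \<Prod>u\<in>e. x u)"
  \<comment> \<open>Reversing orientations shows that both squares in the expansion of
    \<open>R\<close> sum to the same \<open>T\<close>.\<close>
  have T': "T = (\<Sum>(u,v)\<in>?D. (x v)\<^sup>2 * y u / y v)"
    unfolding T_def
    by (rule sum.reindex_bij_witness[of _ "\<lambda>(u,v). (v,u)" "\<lambda>(u,v). (v,u)"])
      (auto simp: insert_commute)
  have q2: "2 * q = (\<Sum>(u,v)\<in>?D. x u * x v)"
  proof -
    have "2 * q = (\<Sum>(u,v)\<in>?D. \<Prod>w\<in>{u,v}. x w)" 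
      unfolding q_def using sum_darts_edges[OF F, of "\<lambda>e. \<Prod>u\<in>e. x u"] by simp
    also have "\<dots> = (\<Sum>(u,v)\<in>?D. x u * x v)"
      by (rule sum.cong) (use inD in \<open>auto\<close>)
    finally show ?thesis .
  qed
  have "R = (\<Sum>(u,v)\<in>?D. (x u)\<^sup>2 * y v / y u + (x v)\<^sup>2 * y u / y v - 2 * (x u * x v))"
    unfolding R_def
  proof (rule sum.cong, simp, clarify)
    fix u v assume "{u,v} \<in> F"
    then have "y u > 0" "y v > 0" using inD y by blast+
    then show "(x u * y v - x v * y u)\<^sup>2 / (y u * y v)
      = (x u)\<^sup>2 * y v / y u + (x v)\<^sup>2 * y u / y v - 2 * (x u * x v)"
      by (simp add: field_simps power2_eq_square)
  qed
  also have "\<dots> = (\<Sum>(u,v)\<in>?D. (x u)\<^sup>2 * y v / y u) + (\<Sum>(u,v)\<in>?D. (x v)\<^sup>2 * y u / y v)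
     - (\<Sum>(u,v)\<in>?D. 2 * (x u * x v))"
    by (simp add: case_prod_unfold sum.distrib sum_subtractf)
  also have "\<dots> = T + T - 2 * (2 * q)"
    using T' T_def q2 by (simp add: case_prod_unfold sum_distrib_left)
  finally have R: "R = 2 * T - 4 * q" by simp
  have "T = (\<Sum>u\<in>{1..n}. (x u)\<^sup>2 * ((\<Sum>v\<in>nbhd n F u. y v) / y u))"
    unfolding T_def sum_darts[OF F]
    by (simp add: sum_distrib_left sum_divide_distrib)
  then have L: "L = b * (\<Sum>u\<in>{1..n}. (x u)\<^sup>2) - T"
    unfolding L_def by (simp add: right_diff_distrib sum_subtractf sum_distrib_left mult.commute)
  have M: "q = M + (\<Sum>e\<in>G. \<Prod>u\<in>e. x u)"
    unfolding q_def M_def by (rule sum.subset_diff[OF GF fF])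
  have Lt: "0 \<le> (x u)\<^sup>2 * (b - (\<Sum>v\<in>nbhd n F u. y v) / y u)" if "u \<in> {1..n}" for u
    using super[OF that] y[OF that] by (intro mult_nonneg_nonneg) (simp_all add: field_simps)
  have Rt: "0 \<le> (x u * y v - x v * y u)\<^sup>2 / (y u * y v)" if "{u,v} \<in> F" for u v
    using y[of u] y[of v] inD[OF that] by simp
  have Mt: "0 \<le> (\<Prod>u\<in>e. x u)" if "e \<in> F - G" for e
  proof (rule prod_nonneg)
    fix u assume "u \<in> e"
    then have "u \<in> {1..n}" using that F unfolding all_pairs_def by blast
    then show "0 \<le> x u" by (rule x)
  qed
  have "L \<ge> 0" "R \<ge> 0" "M \<ge> 0"
    unfolding L_def R_def M_def using Lt Rt Mt by (auto intro!: sum_nonneg)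
  moreover have "L + R / 2 + 2 * M \<le> 0" using L R M big by linarith
  ultimately have z: "L = 0" "R = 0" "M = 0" by linarith+
  show "2 * (\<Sum>e\<in>F. \<Prod>u\<in>e. x u) = b * (\<Sum>u\<in>{1..n}. (x u)\<^sup>2)"
    using z L R unfolding q_def by linarith
  show "x u * y v = x v * y u" if e: "{u, v} \<in> F" for u v
  proof -
    have "\<forall>p\<in>?D. (case p of (u,v) \<Rightarrow> (x u * y v - x v * y u)\<^sup>2 / (y u * y v)) = 0"
      using z(2) Rt fD unfolding R_def by (subst (asm) sum_nonneg_eq_0_iff) auto
    then have "(x u * y v - x v * y u)\<^sup>2 / (y u * y v) = 0" using e by auto
    moreover have "y u > 0" "y v > 0" using inD[OF e] y by blast+
    ultimately show ?thesis by simp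
  qed
  show "x u = 0" if u: "u \<in> {1..n}" and s: "(\<Sum>v\<in>nbhd n F u. y v) < b * y u" for u
  proof -
    have "(x u)\<^sup>2 * (b - (\<Sum>v\<in>nbhd n F u. y v) / y u) = 0"
      using z(1) Lt u unfolding L_def by (subst (asm) sum_nonneg_eq_0_iff) auto
    moreover have "(\<Sum>v\<in>nbhd n F u. y v) / y u < b" using s y[OF u] by (simp add: field_simps)
    ultimately show ?thesis by simp
  qed
  show "(\<Prod>u\<in>e. x u) = 0" if e: "e \<in> F - G" for e
    using z(3) Mt e fF unfolding M_def by (subst (asm) sum_nonneg_eq_0_iff) auto
qed

text \<open>With \<open>C = {1..i - 1}\<close> and \<open>K = {1..2 * m + 2 - i} - C\<close> this is
  \<open>A_graph i n m\<close>. Arbitrary \<open>C\<close> and \<open>K\<close> make the class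
  closed under exchanging two vertices. \<open>C = {}\<close> gives a clique with isolated vertices,
  \<open>K = {}\<close> a clique \<open>C\<close> joined to an independent set.\<close>

definition join_graph :: "nat \<Rightarrow> nat set \<Rightarrow> nat set \<Rightarrow> nat set set" where
  "join_graph n C K = {e \<in> all_pairs n. e \<inter> C \<noteq> {} \<or> e \<subseteq> K}"

lemma join_graph_subset: "join_graph n C K \<subseteq> all_pairs n"
  unfolding join_graph_def by auto

lemma pair_in_join_graph:
  "{u, v} \<in> join_graph n C K \<longleftrightarrow>
     u \<in> {1..n} \<and> v \<in> {1..n} \<and> u \<noteq> v \<and> (u \<in> C \<or> v \<in> C \<or> u \<in> K \<and> v \<in> K)"
  unfolding join_graph_def by (auto simp: pair_in_all_pairs)

text \<open>\<open>w\<close> will be the sum of a test vector over the neighbours of a core vertex,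
  for a core of size \<open>k\<close>. The identity \<open>id\<close> splits
  \<open>m * (b - w)\<close> into a multiple of the slack in the quadratic bound on \<open>b\<close>
  and the term \<open>(m - k) * P\<close> with \<open>P > 0\<close>. Both are nonnegative, and
  \<open>w = b\<close> makes both vanish.\<close>

lemma weight_at_core:
  fixes b m k n :: real
  assumes k: "1 \<le> k" "k \<le> m" and b: "2 * m \<le> b" "(m - 1) * b + m * (n - m) \<le> b\<^sup>2"
  defines "w \<equiv> k - 1 + (2 * m - 2 * k + 1) * (k / (b - 2 * m + 2 * k)) + (n - 2 * m + k - 1) * (k / b)"
  shows "w \<le> b" and "w = b \<Longrightarrow> k = m \<and> (m - 1) * b + m * (n - m) = b\<^sup>2"
proof -
  define s where "s = b - 2 * m + 2 * k"
  have s: "2 * k \<le> s" "s > 0" and b0: "b > 0" and m0: "m > 0" using k b unfolding s_def by auto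
  define P where "P = (b + 1) - k * m * (b + 2 * (m - k + 1)) / (b * s)"
  have id: "m * (b - w) = k / b * (b\<^sup>2 - (m - 1) * b - m * (n - m)) + (m - k) * P"
  proof -
    have "b * s * (m * (b - w)) = b * s * (k / b * (b\<^sup>2 - (m - 1) * b - m * (n - m)) + (m - k) * P)"
    proof -
      have ks: "b * s * (p * (k / s)) = p * (b * k)" "b * s * (p * (k / b)) = p * (s * k)" for p
        using s b0 by auto
      have 1: "b * s * w = b * s * (k - 1) + (2 * m - 2 * k + 1) * (b * k) + (n - 2 * m + k - 1) * (s * k)"
        unfolding w_def s_def[symmetric] distrib_left ks ..
      have 2: "b * s * P = b * s * (b + 1) - k * m * (b + 2 * (m - k + 1))"
        unfolding P_def using s b0 by (simp add: right_diff_distrib)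
      have "b * s * (m * (b - w)) = m * (b * b * s - b * s * w)" by (simp add: algebra_simps)
      also have "\<dots> = s * k * (b\<^sup>2 - (m - 1) * b - m * (n - m)) + (m - k) * (b * s * P)"
        unfolding 1 2 unfolding s_def by (simp add: algebra_simps power2_eq_square)
      also have "\<dots> = b * s * (k / b * (b\<^sup>2 - (m - 1) * b - m * (n - m)) + (m - k) * P)"
      proof -
        have "s * k * z = b * s * (k / b * z)" for z using b0 by simp
        then show ?thesis unfolding distrib_left by (simp only: mult.left_commute)
      qed
      finally show ?thesis .
    qed
    then show ?thesis using s b0 by simp
  qed
  \<comment> \<open>Positivity of \<open>P\<close> after clearing denominators: first
    \<open>2 * (m - k + 1) \<le> 2 * m \<le> b\<close>, then \<open>2 * k \<le> s\<close>, and
    finally \<open>m < b + 1\<close>.\<close>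
  have "k * m * (b + 2 * (m - k + 1)) \<le> k * m * (2 * b)"
    using k b m0 by (intro mult_left_mono) auto
  also have "\<dots> = 2 * k * (m * b)" by simp
  also have "\<dots> \<le> s * (m * b)" using s m0 b0 by (intro mult_right_mono) auto
  also have "\<dots> < s * ((b + 1) * b)" using s m0 b0 b by (intro mult_strict_left_mono mult_strict_right_mono) auto
  finally have P: "P > 0" unfolding P_def using s b0 by (simp add: field_simps)
  have t1: "k / b * (b\<^sup>2 - (m - 1) * b - m * (n - m)) \<ge> 0" using k b b0 by (intro mult_nonneg_nonneg) auto
  have t2: "(m - k) * P \<ge> 0" using k P by simp
  have "m * (b - w) \<ge> 0" using id t1 t2 by linarith
  then show "w \<le> b" using m0 by (simp add: zero_le_mult_iff)
  assume "w = b"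
  then have "k / b * (b\<^sup>2 - (m - 1) * b - m * (n - m)) = 0" "(m - k) * P = 0"
    using id t1 t2 by (simp_all only: diff_self mult_zero_right)
  then show "k = m \<and> (m - 1) * b + m * (n - m) = b\<^sup>2" using k b0 P by auto
qed

text \<open>The maximum in the hypothesis enters only through these two inequalities; the second
  expresses \<open>b\<close> being at least the square-root term, without the root. Equality in the
  first belongs to the clique, equality in the second to the star.\<close>

locale threshold =
  fixes n m :: nat and b :: real
  assumes m_pos: "0 < m" and n_ge: "2 * m + 2 \<le> n" and b_ge: "2 * real m \<le> b"
    and b_sq_ge: "(real m - 1) * b + real m * (real n - real m) \<le> b\<^sup>2"
begin

text \<open>Up to relabelling this concerns \<open>A_graph i n m\<close> with a nonempty core. A
  test vector constant on \<open>C\<close>, on \<open>K\<close> and on the rest is superharmonic by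
  \<open>weight_at_core\<close>. A core vertex is adjacent to all others, so \<open>x\<close> is a
  multiple of the test vector and positive everywhere. This rules out slack at the core and missing
  edges alike.\<close>

lemma join_certificate_rigid:
  assumes CK: "C \<subseteq> {1..n}" "K \<subseteq> {1..n}" "C \<inter> K = {}"
    and k: "1 \<le> card C" "card C \<le> m" "card K = 2 * m + 1 - 2 * card C"
    and G: "G \<subseteq> join_graph n C K" and cert: "spectral_certificate n b G x"
  shows "card C = m" and "G = join_graph n C K"
    and "(real m - 1) * b + real m * (real n - real m) = b\<^sup>2"
    and "\<And>u. u \<in> {1..n} \<Longrightarrow> 0 < x u"
    and "\<And>u v. u \<in> C \<Longrightarrow> v \<in> {1..n} - C \<Longrightarrow> x v < x u"
    and "2 * (\<Sum>e\<in>G. \<Prod>u\<in>e. x u) = b * (\<Sum>u\<in>{1..n}. (x u)\<^sup>2)"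
proof -
  define k where "k = real (card C)"
  \<comment> \<open>\<open>c\<close> and \<open>d\<close> are chosen so that $A y = b y$ holds at every vertex outside \<open>C\<close>.\<close>
  define c where "c = k / (b - 2 * real m + 2 * k)"
  define d where "d = k / b"
  define y where "y u = (if u \<in> C then 1 else if u \<in> K then c else d)" for u
  define F where "F = join_graph n C K"
  have k1: "1 \<le> k" "k \<le> m" using k unfolding k_def by auto
  have b0: "b > 0" using b_ge m_pos by simp
  have den: "b - 2 * real m + 2 * k > 0" using b_ge k1 by simp
  have c: "c > 0" "c * (b - 2 * real m + 2 * k) = k" unfolding c_def using den k1 by auto
  have d: "d > 0" "d * b = k" unfolding d_def using b0 k1 by auto
  have fin: "finite C" "finite K" using CK finite_subset by blast+
  have cK: "real (card K) = 2 * real m - 2 * k + 1" using k unfolding k_def by simp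
  define w where "w = k - 1 + (2 * real m - 2 * k + 1) * (k / (b - 2 * real m + 2 * k))
    + (real n - 2 * real m + k - 1) * (k / b)"
  have sumC: "sum y C = k" unfolding y_def k_def by simp
  have sumK: "sum y K = (2 * real m - 2 * k + 1) * c"
  proof -
    have "sum y K = (\<Sum>u\<in>K. c)" by (rule sum.cong) (use CK in \<open>auto simp: y_def\<close>)
    then show ?thesis using cK by simp
  qed
  have sumR: "sum y ({1..n} - C - K) = (real n - 2 * real m + k - 1) * d"
  proof -
    have "sum y ({1..n} - C - K) = (\<Sum>u\<in>{1..n} - C - K. d)"
      by (rule sum.cong) (auto simp: y_def)
    moreover have "card ({1..n} - C - K) = n - card C - card K"
    proof -
      have "K \<subseteq> {1..n} - C" using CK by auto
      then show ?thesis using CK fin by (simp add: card_Diff_subset)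
    qed
    moreover have "card C + card K \<le> n" using k n_ge by simp
    ultimately have "sum y ({1..n} - C - K) = (real n - (k + real (card K))) * d"
      using k_def by (simp add: of_nat_diff)
    then show ?thesis unfolding cK by (simp add: algebra_simps)
  qed
  have total: "sum y {1..n} = k + (2 * real m - 2 * k + 1) * c + (real n - 2 * real m + k - 1) * d"
  proof -
    have "sum y {1..n} = sum y ({1..n} - C - K) + sum y K + sum y C"
      using CK by (subst sum.subset_diff[of C], simp, simp, subst sum.subset_diff[of K]) auto
    then show ?thesis using sumC sumK sumR by simp
  qed
  have nC: "(\<Sum>v\<in>nbhd n F u. y v) = w" if "u \<in> C" for u
  proof -
    have "nbhd n F u = {1..n} - {u}"
      using that CK unfolding nbhd_def F_def pair_in_join_graph by auto
    then have "(\<Sum>v\<in>nbhd n F u. y v) = sum y {1..n} - y u"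
      using that CK by (simp add: sum_diff1 subset_iff)
    then show ?thesis using total that unfolding w_def c_def d_def y_def by simp
  qed
  have nK: "(\<Sum>v\<in>nbhd n F u. y v) = b * y u" if u: "u \<in> K" for u
  proof -
    have "nbhd n F u = C \<union> (K - {u})"
      using that CK unfolding nbhd_def F_def pair_in_join_graph by auto
    then have "(\<Sum>v\<in>nbhd n F u. y v) = sum y C + (sum y K - y u)"
      using that CK(3) fin by (subst \<open>nbhd n F u = _\<close>, subst sum.union_disjoint) (auto simp: sum_diff1)
    moreover have "y u = c" using u CK unfolding y_def by auto
    ultimately show ?thesis using sumC sumK c(2) by (simp add: algebra_simps)
  qed
  have nR: "(\<Sum>v\<in>nbhd n F u. y v) = b * y u" if u: "u \<in> {1..n}" "u \<notin> C" "u \<notin> K" for u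
  proof -
    have "nbhd n F u = C"
      using that CK unfolding nbhd_def F_def pair_in_join_graph by auto
    then show ?thesis using sumC d(2) u unfolding y_def by (simp add: mult.commute)
  qed
  note wb = weight_at_core[of k m b n, OF k1 b_ge b_sq_ge, folded w_def]
  have y0: "y u > 0" for u unfolding y_def using c d by simp
  have super: "(\<Sum>v\<in>nbhd n F u. y v) \<le> b * y u" if "u \<in> {1..n}" for u
  proof (cases "u \<in> C")
    case True then show ?thesis using nC wb(1) by (simp add: y_def)
  next
    case False then show ?thesis using nK nR that by (cases "u \<in> K") auto
  qed
  then have superharmonic: "\<forall>u\<in>{1..n}. (\<Sum>v\<in>nbhd n F u. y v) \<le> b * y u" by blast
  note rigid = certificate_rigid[OF join_graph_subset[of n C K, folded F_def] G[folded F_def] cert, of y, OF ballI superharmonic, OF y0]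
  obtain a where a: "a \<in> C" using k by (metis card.empty ex_in_conv not_one_le_zero)
  have an: "a \<in> {1..n}" using a CK by auto
  have xa: "x u = x a * y u" if "u \<in> {1..n}" for u
  proof (cases "u = a")
    case False
    then have "{a, u} \<in> F" using that a an unfolding F_def pair_in_join_graph by auto
    then show ?thesis using rigid(1)[of a u] a by (simp add: y_def)
  qed (use a in \<open>simp add: y_def\<close>)
  have xn: "\<And>u. u \<in> {1..n} \<Longrightarrow> 0 \<le> x u" "\<exists>u\<in>{1..n}. x u \<noteq> 0"
    using cert unfolding spectral_certificate_def by auto
  have xa0: "x a > 0"
  proof -
    have "x a \<noteq> 0" using xa xn(2) by auto
    then show ?thesis using xn(1)[OF an] by simp
  qed
  show pos: "0 < x u" if "u \<in> {1..n}" for u using xa[OF that] xa0 y0[of u] by simp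
  have "w = b"
  proof (rule ccontr)
    assume "w \<noteq> b"
    then have "x a = 0" using rigid(2)[OF an] nC[OF a] wb(1) a by (simp add: y_def)
    then show False using xa0 by simp
  qed
  then have km: "k = m" and tight: "(real m - 1) * b + real m * (real n - real m) = b\<^sup>2" using wb(2) by auto
  show "card C = m" using km unfolding k_def by simp
  show "(real m - 1) * b + real m * (real n - real m) = b\<^sup>2" by (rule tight)
  show "G = join_graph n C K"
  proof (rule ccontr)
    assume "G \<noteq> join_graph n C K"
    then obtain e where e: "e \<in> F - G" using G unfolding F_def by auto
    then have "e \<subseteq> {1..n}" unfolding F_def join_graph_def all_pairs_def by auto
    then have "(\<Prod>u\<in>e. x u) > 0" using pos by (intro prod_pos) auto
    then show False using rigid(3)[OF e] by simp
  qed
  then show "2 * (\<Sum>e\<in>G. \<Prod>u\<in>e. x u) = b * (\<Sum>u\<in>{1..n}. (x u)\<^sup>2)"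
    using rigid(4) unfolding F_def by simp
  \<comment> \<open>Since \<open>k = m\<close>, the values \<open>c\<close> and \<open>d\<close>
    coincide: outside the core the test vector is \<open>m / b\<close>, at most one half, against 1
    on the core.\<close>
  show "x v < x u" if "u \<in> C" "v \<in> {1..n} - C" for u v
  proof -
    have "y v = d" using that km unfolding y_def c_def d_def by simp
    moreover have "d < 1" unfolding d_def using km b_ge b0 m_pos by simp
    moreover have "x u = x a" using xa[of u] that CK unfolding y_def by auto
    ultimately show ?thesis using xa[of v] that xa0 by simp
  qed
qed

text \<open>The test vector is constantly 1: a vertex of \<open>K\<close> sees \<open>2 * m\<close>,
  any other vertex sees 0. The slack outside \<open>K\<close> makes \<open>x\<close> vanish there,
  and the edges inside \<open>K\<close> make it constant on \<open>K\<close>, hence positive. So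
  there is no slack on \<open>K\<close> and no edge is missing.\<close>

lemma clique_certificate_rigid:
  assumes K: "K \<subseteq> {1..n}" "card K = 2 * m + 1"
    and G: "G \<subseteq> join_graph n {} K" and cert: "spectral_certificate n b G x"
  shows "b = 2 * real m" and "G = join_graph n {} K"
    and "\<And>u. u \<in> K \<Longrightarrow> 0 < x u" and "\<And>u. u \<in> {1..n} - K \<Longrightarrow> x u = 0"
    and "2 * (\<Sum>e\<in>G. \<Prod>u\<in>e. x u) = b * (\<Sum>u\<in>{1..n}. (x u)\<^sup>2)"
proof -
  define F where "F = join_graph n {} K"
  have fin: "finite K" using K finite_subset by auto
  have b0: "b > 0" using b_ge m_pos by simp
  have nK: "(\<Sum>v\<in>nbhd n F u. 1) = 2 * real m" if u: "u \<in> K" for u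
  proof -
    have "nbhd n F u = K - {u}"
      using that K unfolding nbhd_def F_def pair_in_join_graph by auto
    then show ?thesis using K fin u by simp
  qed
  have nR: "(\<Sum>v\<in>nbhd n F u. 1) = (0::real)" if u: "u \<notin> K" for u
  proof -
    have "nbhd n F u = {}" using that unfolding nbhd_def F_def pair_in_join_graph by auto
    then show ?thesis by simp
  qed
  have super: "(\<Sum>v\<in>nbhd n F u. 1) \<le> b * 1" if "u \<in> {1..n}" for u
    using nK[of u] nR[of u] b_ge b0 by (cases "u \<in> K") auto
  then have superharmonic: "\<forall>u\<in>{1..n}. (\<Sum>v\<in>nbhd n F u. 1) \<le> b * 1" by blast
  have one: "\<forall>u\<in>{1..n}. 0 < (1::real)" by simp
  note rigid = certificate_rigid[OF join_graph_subset[of n "{}" K, folded F_def] G[folded F_def] cert,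
      of "\<lambda>_. 1", OF one superharmonic]
  show out: "x u = 0" if "u \<in> {1..n} - K" for u
    using rigid(2)[of u] nR[of u] b0 that by simp
  have eq: "x u = x v" if "u \<in> K" "v \<in> K" for u v
  proof (cases "u = v")
    case False
    then have "{u, v} \<in> F" using that K unfolding F_def pair_in_join_graph by auto
    then show ?thesis using rigid(1) by simp
  qed simp
  have xn: "\<And>u. u \<in> {1..n} \<Longrightarrow> 0 \<le> x u" "\<exists>u\<in>{1..n}. x u \<noteq> 0"
    using cert unfolding spectral_certificate_def by auto
  then obtain a where a: "a \<in> {1..n}" "x a \<noteq> 0" by auto
  then have aK: "a \<in> K" using out by auto
  have xa: "x a > 0" using a xn(1)[of a] by simp
  show pos: "0 < x u" if "u \<in> K" for u using eq[OF that aK] xa by simp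
  show "b = 2 * real m" using rigid(2)[of a] nK[OF aK] b_ge a by force
  show "G = join_graph n {} K"
  proof (rule ccontr)
    assume "G \<noteq> join_graph n {} K"
    then obtain e where e: "e \<in> F - G" using G unfolding F_def by auto
    then have "e \<subseteq> K" unfolding F_def join_graph_def by auto
    then have "(\<Prod>u\<in>e. x u) > 0" using pos by (intro prod_pos) auto
    then show False using rigid(3)[of e] e by simp
  qed
  then show "2 * (\<Sum>e\<in>G. \<Prod>u\<in>e. x u) = b * (\<Sum>u\<in>{1..n}. (x u)\<^sup>2)"
    using rigid(4) unfolding F_def by simp
qed

end

subsection \<open>Shifting\<close>

definition flip :: "nat \<Rightarrow> nat \<Rightarrow> nat set \<Rightarrow> nat set" where
  "flip a b e = transpose a b ` e"

text \<open>The usual compression: an edge whose image is already present stays, so that shifting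
  preserves the number of edges.\<close>

definition shift_edge :: "nat \<Rightarrow> nat \<Rightarrow> nat set set \<Rightarrow> nat set \<Rightarrow> nat set" where
  "shift_edge a b G e = (if b \<in> e \<and> a \<notin> e \<and> flip a b e \<notin> G then flip a b e else e)"

definition shift :: "nat \<Rightarrow> nat \<Rightarrow> nat set set \<Rightarrow> nat set set" where
  "shift a b G = shift_edge a b G ` G"

lemma flip_flip [simp]: "flip a b (flip a b e) = e"
  unfolding flip_def by (simp add: image_image)

lemma flip_commute: "flip a b = flip b a"
  unfolding flip_def by (simp add: transpose_commute)

lemma mem_flip [simp]: "a \<in> flip a b e \<longleftrightarrow> b \<in> e" "b \<in> flip a b e \<longleftrightarrow> a \<in> e"
  unfolding flip_def by (auto simp: image_iff transpose_def)

lemma flip_eq_self: "(b \<in> e \<longleftrightarrow> a \<in> e) \<Longrightarrow> flip a b e = e"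
  unfolding flip_def by (rule transpose_image_eq) auto

lemma flip_pair: "v \<noteq> a \<Longrightarrow> v \<noteq> b \<Longrightarrow> flip a b {b, v} = {a, v}"
  unfolding flip_def by simp

lemma flip_disjoint: "e \<inter> f = {} \<Longrightarrow> flip a b e \<inter> flip a b f = {}"
  unfolding flip_def by (simp add: image_Int[symmetric] inj_transpose)

text \<open>Moved edges land outside \<open>G\<close> and the others stay inside it, so a collision
  can only involve two moved or two unmoved edges.\<close>

lemma inj_on_shift_edge: "inj_on (shift_edge a b G) G"
proof (rule inj_onI)
  fix e f assume ef: "e \<in> G" "f \<in> G" "shift_edge a b G e = shift_edge a b G f"
  have "e = f" if "flip a b e = flip a b f" using that by (metis flip_flip)
  then show "e = f" using ef unfolding shift_edge_def by (simp split: if_splits)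
qed

lemma flip_all_pairs:
  assumes "e \<in> all_pairs n" "a \<in> {1..n}" "b \<in> {1..n}"
  shows "flip a b e \<in> all_pairs n"
proof -
  have e: "e \<subseteq> {1..n}" "card e = 2" using assms unfolding all_pairs_def by auto
  have "card (flip a b e) = 2" unfolding flip_def using e(2) card_image[OF inj_on_subset[OF inj_transpose]]
    by (metis subset_UNIV)
  moreover have "flip a b e \<subseteq> {1..n}"
    unfolding flip_def using e(1) assms(2,3) by (auto simp: transpose_def)
  ultimately show ?thesis unfolding all_pairs_def by simp
qed

lemma shift_all_pairs:
  assumes "G \<subseteq> all_pairs n" "a \<in> {1..n}" "b \<in> {1..n}"
  shows "shift a b G \<subseteq> all_pairs n"
  unfolding shift_def shift_edge_def using assms flip_all_pairs by auto

text \<open>In an orbit of \<open>flip a b\<close> with two edges the shift fills the edge through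
  \<open>a\<close> first; only the number of its edges in \<open>G\<close> matters.\<close>

lemma mem_shift:
  "e \<in> shift a b G \<longleftrightarrow>
     (if a \<in> e \<and> b \<notin> e then e \<in> G \<or> flip a b e \<in> G
      else if b \<in> e \<and> a \<notin> e then e \<in> G \<and> flip a b e \<in> G else e \<in> G)" (is "_ = ?R")
proof
  assume "e \<in> shift a b G"
  then obtain f where f: "f \<in> G" "e = shift_edge a b G f" unfolding shift_def by auto
  show ?R
  proof (cases "b \<in> f \<and> a \<notin> f \<and> flip a b f \<notin> G")
    case True
    then have "e = flip a b f" using f unfolding shift_edge_def by simp
    then show ?thesis using True f by simp
  next
    case False
    then have "e = f" using f(2) unfolding shift_edge_def by argo
    then show ?thesis using False f(1) by auto
  qed
next
  assume R: ?R
  have "\<exists>f\<in>G. e = shift_edge a b G f"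
  proof (cases "e \<in> G")
    case True
    then have "e = shift_edge a b G e" using R unfolding shift_edge_def by auto
    then show ?thesis using True by blast
  next
    case False
    then have "flip a b e \<in> G" "a \<in> e" "b \<notin> e" using R by (auto split: if_splits)
    moreover from this have "e = shift_edge a b G (flip a b e)"
      using False unfolding shift_edge_def by simp
    ultimately show ?thesis by blast
  qed
  then show "e \<in> shift a b G" unfolding shift_def by blast
qed

text \<open>Shifting towards \<open>a\<close> and towards \<open>b\<close> give graphs that differ by exchanging \<open>a\<close> and \<open>b\<close>,
  so one may choose the direction that suits a given vector.\<close>

lemma shift_opposite: "e \<in> shift b a G \<longleftrightarrow> flip a b e \<in> shift a b G"
proof (cases "b \<in> e \<longleftrightarrow> a \<in> e")
  case True
  then show ?thesis unfolding flip_eq_self[OF True] mem_shift by simp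
next
  case False
  then show ?thesis unfolding mem_shift flip_commute[of b a] by auto
qed

lemma moved_edge:
  assumes "shift a b G \<noteq> G"
  obtains e where "e \<in> G" "b \<in> e" "a \<notin> e" "flip a b e \<notin> G"
proof -
  have "\<exists>e\<in>G. b \<in> e \<and> a \<notin> e \<and> flip a b e \<notin> G"
  proof (rule ccontr)
    assume "\<not> ?thesis"
    then have "shift_edge a b G e = e" if "e \<in> G" for e using that unfolding shift_edge_def by auto
    then have "shift a b G = G" unfolding shift_def by simp
    then show False using assms by simp
  qed
  then show ?thesis using that by blast
qed

text \<open>If the given matching fails for \<open>G\<close>, some \<open>e p\<close> is a new edge,
  containing \<open>a\<close> but not \<open>b\<close>. Disjointness keeps \<open>a\<close> out of
  all other edges. Exchanging \<open>a\<close> and \<open>b\<close> throughout then works: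
  \<open>e p\<close> returns to its origin, and an \<open>e i\<close> through \<open>b\<close>
  survived the shift only because its flip also lies in \<open>G i\<close>.\<close>

lemma has_rainbow_matching_shift:
  assumes "has_rainbow_matching t (\<lambda>i. shift a b (G i))"
  shows "has_rainbow_matching t G"
proof -
  obtain e where e: "\<And>i. i \<in> {1..t} \<Longrightarrow> e i \<in> shift a b (G i)"
    "\<And>i j. i \<in> {1..t} \<Longrightarrow> j \<in> {1..t} \<Longrightarrow> i \<noteq> j \<Longrightarrow> e i \<inter> e j = {}"
    using assms unfolding has_rainbow_matching_def by blast
  show ?thesis
  proof (cases "\<forall>i\<in>{1..t}. e i \<in> G i")
    case True
    then show ?thesis using e(2) unfolding has_rainbow_matching_def by blast
  next
    case False
    then obtain p where p: "p \<in> {1..t}" "e p \<notin> G p" by blast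
    then have p': "a \<in> e p" "b \<notin> e p" "flip a b (e p) \<in> G p"
      using e(1)[OF p(1)] unfolding mem_shift by (auto split: if_splits)
    have "flip a b (e i) \<in> G i" if i: "i \<in> {1..t}" for i
    proof (cases "i = p")
      case False
      then have "a \<notin> e i" using e(2)[OF i p(1)] p' by blast
      then show ?thesis using e(1)[OF i] flip_eq_self[of b "e i" a] unfolding mem_shift
        by (cases "b \<in> e i") simp_all
    qed (use p' in simp)
    moreover have "flip a b (e i) \<inter> flip a b (e j) = {}" if "i \<in> {1..t}" "j \<in> {1..t}" "i \<noteq> j" for i j
      using e(2)[OF that] by (rule flip_disjoint)
    ultimately show ?thesis unfolding has_rainbow_matching_def
      by (intro exI[of _ "\<lambda>i. flip a b (e i)"] conjI ballI impI)
  qed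
qed

section \<open>Effect of a shift on the quadratic form, and its reversal\<close>

lemma flip_end:
  assumes "e \<in> all_pairs n" "b \<in> e" "a \<notin> e"
  obtains v where "v \<in> {1..n}" "v \<noteq> a" "v \<noteq> b" "e = {b, v}" "flip a b e = {a, v}"
proof -
  obtain u w where uw: "e = {u, w}" "u \<noteq> w" "u \<in> {1..n}" "w \<in> {1..n}"
    using assms(1) by (auto elim: all_pairs_cases)
  define v where "v = (if b = u then w else u)"
  have "e = {b, v}" "v \<in> {1..n}" "v \<noteq> b" using uw assms(2) unfolding v_def by auto
  moreover have "v \<noteq> a" using assms(3) calculation by auto
  ultimately show ?thesis using that[of v] flip_pair[of v a b] by simp
qed

text \<open>Moving \<open>{b, v}\<close> to \<open>{a, v}\<close> changes its term by
  \<open>(x a - x b) * x v\<close>. Equality of the sums makes this vanish for every moved edge,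
  which the extra hypotheses exclude.\<close>

lemma shift_form_le:
  fixes x :: "nat \<Rightarrow> real"
  assumes G: "G \<subseteq> all_pairs n" and x: "\<forall>u\<in>{1..n}. 0 \<le> x u" and ab: "x b \<le> x a"
  shows "(\<Sum>e\<in>G. \<Prod>u\<in>e. x u) \<le> (\<Sum>e\<in>shift a b G. \<Prod>u\<in>e. x u)"
    and "(\<Sum>e\<in>G. \<Prod>u\<in>e. x u) = (\<Sum>e\<in>shift a b G. \<Prod>u\<in>e. x u) \<Longrightarrow> x b \<noteq> x a \<Longrightarrow>
         (\<And>v. {a, v} \<in> shift a b G \<Longrightarrow> x v \<noteq> 0) \<Longrightarrow> shift a b G = G"
proof -
  have fG: "finite G" using G finite_all_pairs finite_subset by blast
  have S: "(\<Sum>e\<in>shift a b G. \<Prod>u\<in>e. x u) = (\<Sum>e\<in>G. \<Prod>u\<in>shift_edge a b G e. x u)"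
    unfolding shift_def by (simp add: sum.reindex[OF inj_on_shift_edge])
  have le: "(\<Prod>u\<in>e. x u) \<le> (\<Prod>u\<in>shift_edge a b G e. x u)" if e: "e \<in> G" for e
  proof (cases "shift_edge a b G e = e")
    case False
    then have m: "b \<in> e" "a \<notin> e" "shift_edge a b G e = flip a b e"
      unfolding shift_edge_def by (auto split: if_splits)
    obtain v where v: "v \<in> {1..n}" "v \<noteq> a" "v \<noteq> b" "e = {b, v}" "flip a b e = {a, v}"
      using flip_end[of e n b a] m e G by blast
    show ?thesis unfolding m(3) v(5) unfolding v(4) using v(2,3) bspec[OF x v(1)] ab by (simp add: mult_right_mono)
  qed simp
  show "(\<Sum>e\<in>G. \<Prod>u\<in>e. x u) \<le> (\<Sum>e\<in>shift a b G. \<Prod>u\<in>e. x u)"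
    unfolding S by (rule sum_mono[OF le])
  assume eq: "(\<Sum>e\<in>G. \<Prod>u\<in>e. x u) = (\<Sum>e\<in>shift a b G. \<Prod>u\<in>e. x u)" and ne: "x b \<noteq> x a"
    and nz: "\<And>v. {a, v} \<in> shift a b G \<Longrightarrow> x v \<noteq> 0"
  show "shift a b G = G"
  proof (rule ccontr)
    assume "shift a b G \<noteq> G"
    then obtain e where e: "e \<in> G" "b \<in> e" "a \<notin> e" "flip a b e \<notin> G" by (rule moved_edge)
    obtain v where v: "v \<in> {1..n}" "v \<noteq> a" "v \<noteq> b" "e = {b, v}" "flip a b e = {a, v}"
      using flip_end[of e n b a] e G by blast
    have s: "shift_edge a b G e = {a, v}" using e v(5) unfolding shift_edge_def by simp
    have "(\<Prod>u\<in>e. x u) = (\<Prod>u\<in>shift_edge a b G e. x u)"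
      using sum_mono_inv[OF eq[unfolded S] le e(1) fG] .
    then have "x b * x v = x a * x v" using s v by simp
    moreover have "x v \<noteq> 0" using nz[of v] s e(1) unfolding shift_def by force
    ultimately show False using ne by simp
  qed
qed

lemma inj_flip: "inj (flip a b)"
  by (rule injI) (metis flip_flip)

lemma mem_flip_image: "e \<in> flip a b ` F \<longleftrightarrow> flip a b e \<in> F"
  by (metis flip_flip image_iff)

lemma shift_eq_flip_image: "shift b a G = flip a b ` shift a b G"
  by (rule Set.set_eqI) (unfold mem_flip_image, rule shift_opposite)

lemma flip_image_join_graph:
  assumes "a \<in> {1..n}" "b \<in> {1..n}"
  shows "flip a b ` join_graph n C K = join_graph n (flip a b C) (flip a b K)"
proof (rule Set.set_eqI)
  fix e
  have 1: "flip a b e \<in> all_pairs n \<longleftrightarrow> e \<in> all_pairs n"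
    using flip_all_pairs[OF _ assms] by (metis flip_flip)
  have 2: "flip a b e \<inter> C = {} \<longleftrightarrow> e \<inter> flip a b C = {}"
    using flip_disjoint[of "flip a b e" C a b] flip_disjoint[of e "flip a b C" a b] by auto
  have 3: "flip a b e \<subseteq> K \<longleftrightarrow> e \<subseteq> flip a b K"
    unfolding flip_def by (metis flip_def flip_flip image_mono)
  show "e \<in> flip a b ` join_graph n C K \<longleftrightarrow> e \<in> join_graph n (flip a b C) (flip a b K)"
    unfolding mem_flip_image join_graph_def mem_Collect_eq 1 2 3 ..
qed

lemma flip_empty: "flip a b {} = {}"
  unfolding flip_def by simp

lemma card_flip: "card (flip a b K) = card K"
  unfolding flip_def by (rule card_image) (rule inj_on_subset[OF inj_transpose], simp)

lemma flip_subset: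
  assumes "K \<subseteq> {1..n}" "a \<in> {1..n}" "b \<in> {1..n}"
  shows "flip a b K \<subseteq> {1..n}"
  unfolding flip_def using assms by (auto simp: transpose_def)

lemma flip_form:
  fixes x :: "nat \<Rightarrow> real"
  shows "(\<Sum>e\<in>flip a b ` F. \<Prod>u\<in>e. x (transpose a b u)) = (\<Sum>e\<in>F. \<Prod>u\<in>e. x u)"
proof -
  have "(\<Prod>u\<in>flip a b e. x (transpose a b u)) = (\<Prod>u\<in>e. x u)" for e
    unfolding flip_def by (subst prod.reindex) (simp_all add: inj_on_subset[OF inj_transpose])
  then show ?thesis by (simp add: sum.reindex inj_on_subset[OF inj_flip])
qed

lemma transpose_norm:
  fixes x :: "nat \<Rightarrow> real"
  assumes "a \<in> {1..n}" "b \<in> {1..n}"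
  shows "(\<Sum>u\<in>{1..n}. (x (transpose a b u))\<^sup>2) = (\<Sum>u\<in>{1..n}. (x u)\<^sup>2)"
proof -
  have "transpose a b ` {1..n} = {1..n}" using assms by (intro transpose_image_eq) simp
  then have "bij_betw (transpose a b) {1..n} {1..n}"
    by (simp add: bij_betw_def inj_on_subset[OF inj_transpose])
  then show ?thesis by (rule sum.reindex_bij_betw)
qed

lemma certificate_flip:
  assumes ab: "a \<in> {1..n}" "b \<in> {1..n}" and cert: "spectral_certificate n r F x"
  shows "spectral_certificate n r (flip a b ` F) (\<lambda>u. x (transpose a b u))"
proof -
  have t: "transpose a b u \<in> {1..n}" if "u \<in> {1..n}" for u
    using that ab by (auto simp: transpose_def)
  have c: "\<And>u. u \<in> {1..n} \<Longrightarrow> 0 \<le> x u" "\<exists>u\<in>{1..n}. x u \<noteq> 0"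
    "r * (\<Sum>u\<in>{1..n}. (x u)\<^sup>2) \<le> 2 * (\<Sum>e\<in>F. \<Prod>u\<in>e. x u)"
    using cert unfolding spectral_certificate_def by auto
  obtain u where u: "u \<in> {1..n}" "x u \<noteq> 0" using c(2) by blast
  show ?thesis unfolding spectral_certificate_def flip_form transpose_norm[OF ab]
  proof (intro conjI ballI)
    show "0 \<le> x (transpose a b u)" if "u \<in> {1..n}" for u using c(1)[OF t[OF that]] .
    show "\<exists>u\<in>{1..n}. x (transpose a b u) \<noteq> 0" using u t[OF u(1)] by (intro bexI[of _ "transpose a b u"]) auto
  qed (rule c(3))
qed

lemma certificate_shift_same:
  assumes G: "G \<subseteq> all_pairs n" and cert: "spectral_certificate n r G x" and ab: "x b \<le> x a"
  shows "spectral_certificate n r (shift a b G) x"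
proof -
  have x: "\<forall>u\<in>{1..n}. 0 \<le> x u" using cert unfolding spectral_certificate_def by auto
  show ?thesis using cert shift_form_le(1)[OF G x ab] unfolding spectral_certificate_def by auto
qed

text \<open>When \<open>x\<close> is larger at \<open>b\<close>, it remains a certificate for the
  shift towards \<open>b\<close>; exchanging the two vertices turns that graph into
  \<open>shift a b G\<close>.\<close>

lemma certificate_shift_other:
  assumes G: "G \<subseteq> all_pairs n" and cert: "spectral_certificate n r G x" and le: "x a \<le> x b"
    and ab: "a \<in> {1..n}" "b \<in> {1..n}"
  shows "spectral_certificate n r (shift a b G) (\<lambda>u. x (transpose a b u))"
  using certificate_flip[OF ab certificate_shift_same[OF G cert le]]
  unfolding shift_eq_flip_image[of a b G] flip_commute[of b a] .

lemma certificate_shift: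
  assumes G: "G \<subseteq> all_pairs n" and cert: "spectral_certificate n r G x"
    and ab: "a \<in> {1..n}" "b \<in> {1..n}"
  shows "\<exists>z. spectral_certificate n r (shift a b G) z"
  using certificate_shift_same[OF G cert] certificate_shift_other[OF G cert _ ab]
  by (metis linear)

text \<open>By \<open>tight\<close> every certificate of \<open>H\<close> attains equality, so
  shifting in the direction that suits \<open>x\<close> leaves the form unchanged. By
  \<open>ne\<close> and \<open>nz\<close> the equality case of \<open>shift_form_le\<close> then
  says that this shift moved nothing. Towards \<open>a\<close> this gives \<open>H\<close>, towards
  \<open>b\<close> its exchanged copy.\<close>

lemma unshift_rigid:
  assumes G: "G \<subseteq> all_pairs n" and cert: "spectral_certificate n r G x"
    and ab: "a \<in> {1..n}" "b \<in> {1..n}" and H: "shift a b G = H"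
    and tight: "\<And>z. spectral_certificate n r H z \<Longrightarrow>
      2 * (\<Sum>e\<in>H. \<Prod>u\<in>e. z u) = r * (\<Sum>u\<in>{1..n}. (z u)\<^sup>2)"
    and ne: "\<And>z. spectral_certificate n r H z \<Longrightarrow> z a \<noteq> z b"
    and nz: "\<And>z v. spectral_certificate n r H z \<Longrightarrow> {a, v} \<in> H \<Longrightarrow> z v \<noteq> 0"
  shows "G = H \<or> G = flip a b ` H"
proof -
  have x: "\<forall>u\<in>{1..n}. 0 \<le> x u" and
    big: "r * (\<Sum>u\<in>{1..n}. (x u)\<^sup>2) \<le> 2 * (\<Sum>e\<in>G. \<Prod>u\<in>e. x u)"
    using cert unfolding spectral_certificate_def by auto
  show ?thesis
  proof (cases "x b \<le> x a")
    case True
    have c: "spectral_certificate n r H x" using certificate_shift_same[OF G cert True] H by simp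
    have "(\<Sum>e\<in>G. \<Prod>u\<in>e. x u) = (\<Sum>e\<in>shift a b G. \<Prod>u\<in>e. x u)"
      using shift_form_le(1)[OF G x True] tight[OF c] big unfolding H by linarith
    then have "shift a b G = G"
      by (rule shift_form_le(2)[OF G x True]) (use ne[OF c] nz[OF c] H in auto)
    then show ?thesis using H by simp
  next
    case False
    then have le: "x a \<le> x b" by simp
    define z where "z u = x (transpose a b u)" for u
    have c: "spectral_certificate n r H z"
      using certificate_shift_other[OF G cert le ab] H unfolding z_def by simp
    have S: "shift b a G = flip a b ` H" unfolding shift_eq_flip_image[of b a] H ..
    have q: "(\<Sum>e\<in>shift b a G. \<Prod>u\<in>e. x u) = (\<Sum>e\<in>H. \<Prod>u\<in>e. z u)"
      unfolding S using flip_form[of z a b H] by (simp add: z_def)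
    have N: "(\<Sum>u\<in>{1..n}. (z u)\<^sup>2) = (\<Sum>u\<in>{1..n}. (x u)\<^sup>2)"
      unfolding z_def by (rule transpose_norm[OF ab])
    have "(\<Sum>e\<in>G. \<Prod>u\<in>e. x u) = (\<Sum>e\<in>shift b a G. \<Prod>u\<in>e. x u)"
      using shift_form_le(1)[OF G x le] tight[OF c, unfolded N] big q by linarith
    moreover have "x a \<noteq> x b" using ne[OF c] by (simp add: z_def)
    \<comment> \<open>\<open>nz\<close> speaks of neighbours of \<open>a\<close> in
      \<open>H\<close>; the exchange carries it over to neighbours of \<open>b\<close> in
      \<open>shift b a G\<close>.\<close>
    moreover have "x v \<noteq> 0" if v: "{b, v} \<in> shift b a G" for v
    proof -
      have "{b, v} \<in> all_pairs n" using v shift_all_pairs[OF G ab(2) ab(1)] by blast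
      then have bv: "b \<noteq> v" by (simp add: pair_in_all_pairs)
      have "{transpose a b b, transpose a b v} \<in> H"
        using v unfolding S mem_flip_image by (simp add: flip_def)
      then have "z (transpose a b v) \<noteq> 0" using nz[OF c] by simp
      then show ?thesis by (simp add: z_def)
    qed
    ultimately have "shift b a G = G" using shift_form_le(2)[OF G x le] by blast
    then show ?thesis using S by simp
  qed
qed

text \<open>Purely combinatorial: a moved edge \<open>e\<close> is lost while its flip appears,
  against the invariance of \<open>H\<close>.\<close>

lemma unshift_twins:
  assumes "shift a b G = H" and "flip a b ` H = H"
  shows "G = H"
proof (rule ccontr)
  assume "G \<noteq> H"
  then have "shift a b G \<noteq> G" using assms by simp
  then obtain e where e: "e \<in> G" "b \<in> e" "a \<notin> e" "flip a b e \<notin> G" by (rule moved_edge)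
  then have "e \<notin> H" "flip a b e \<in> H" unfolding assms(1)[symmetric] mem_shift by auto
  then show False using mem_flip_image[of e a b H] unfolding assms(2) by simp
qed

text \<open>Two members take the prescribed edges. The other \<open>t - 2\<close> take pairs chosen
  by injections of their indices into \<open>A\<close> and into \<open>B\<close>.\<close>

lemma rainbow_matching_from_bipartite:
  assumes pq: "p \<in> {1..t}" "q \<in> {1..t}" "p \<noteq> q"
    and e: "e1 \<in> G p" "e2 \<in> G q" "e1 \<inter> e2 = {}"
    and fin: "finite A" "finite B" and card: "t \<le> card A + 2" "t \<le> card B + 2"
    and disj: "A \<inter> B = {}" "(A \<union> B) \<inter> (e1 \<union> e2) = {}"
    and all: "\<And>i u v. i \<in> {1..t} \<Longrightarrow> u \<in> A \<Longrightarrow> v \<in> B \<Longrightarrow> {u, v} \<in> G i"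
  shows "has_rainbow_matching t G"
proof -
  define I where "I = {1..t} - {p, q}"
  have I: "finite I" "card I = t - 2" unfolding I_def using pq by (auto simp: card_Diff_subset)
  obtain f where f: "f ` I \<subseteq> A" "inj_on f I" using card_le_inj[OF I(1) fin(1)] I(2) card(1) by (metis le_diff_conv)
  obtain g where g: "g ` I \<subseteq> B" "inj_on g I" using card_le_inj[OF I(1) fin(2)] I(2) card(2) by (metis le_diff_conv)
  define h where "h i = (if i = p then e1 else if i = q then e2 else {f i, g i})" for i
  have fg: "f i \<in> A" "g i \<in> B" if "i \<in> I" for i using f g that by auto
  have "h i \<in> G i" if i: "i \<in> {1..t}" for i
  proof (cases "i \<in> I")
    case True
    then show ?thesis using all[OF i fg] unfolding h_def I_def by simp
  next
    case False
    then have "i = p \<or> i = q" using i unfolding I_def by simp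
    then show ?thesis using e pq unfolding h_def by auto
  qed
  moreover have "h i \<inter> h j = {}" if ij: "i \<in> {1..t}" "j \<in> {1..t}" "i \<noteq> j" for i j
  proof -
    have sub: "h k \<subseteq> A \<union> B" if "k \<in> I" for k
      using fg[OF that] that unfolding h_def I_def by simp
    have sub2: "h k \<subseteq> e1 \<union> e2" if "k = p \<or> k = q" for k
      using that unfolding h_def by auto
    consider "i \<in> I" "j \<in> I" | "i \<in> I" "j = p \<or> j = q" | "i = p \<or> i = q" "j \<in> I"
      | "i = p \<or> i = q" "j = p \<or> j = q" using ij unfolding I_def by blast
    then show ?thesis
    proof cases
      case 1
      have "f i \<noteq> f j" "g i \<noteq> g j" using inj_onD[OF f(2) _ 1] inj_onD[OF g(2) _ 1] ij(3) by auto
      moreover have "f i \<noteq> g j" "g i \<noteq> f j" using fg[OF 1(1)] fg[OF 1(2)] disj(1) by auto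
      ultimately show ?thesis using 1 unfolding h_def I_def by auto
    next
      case 2 then show ?thesis using sub[OF 2(1)] sub2[OF 2(2)] disj(2) by blast
    next
      case 3 then show ?thesis using sub[OF 3(2)] sub2[OF 3(1)] disj(2) by blast
    next
      case 4 then show ?thesis using e(3) pq(3) ij(3) unfolding h_def by auto
    qed
  qed
  ultimately show ?thesis unfolding has_rainbow_matching_def by (intro exI[of _ h] conjI ballI impI)
qed

lemma mem_flip_iff: "u \<in> flip a c K \<longleftrightarrow> transpose a c u \<in> K"
  unfolding flip_def by (metis image_eqI imageE transpose_involutory)

text \<open>The sum of the labels of all edge ends decreases when \<open>c\<close> is replaced by
  the smaller \<open>a\<close>. It is the measure for the induction in
  \<open>no_rainbow_structure\<close>.\<close>

lemma shift_weight:
  assumes G: "G \<subseteq> all_pairs n" and ac: "a < c"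
  shows "(\<Sum>e\<in>shift a c G. \<Sum>e) \<le> (\<Sum>e\<in>G. \<Sum>e)"
    and "shift a c G \<noteq> G \<Longrightarrow> (\<Sum>e\<in>shift a c G. \<Sum>e) < (\<Sum>e\<in>G. \<Sum>e)"
proof -
  have fG: "finite G" using G finite_all_pairs finite_subset by blast
  have S: "(\<Sum>e\<in>shift a c G. \<Sum>e) = (\<Sum>e\<in>G. \<Sum>(shift_edge a c G e))"
    unfolding shift_def by (simp add: sum.reindex[OF inj_on_shift_edge])
  have less: "\<Sum>(flip a c e) < \<Sum>e" if e: "e \<in> G" "c \<in> e" "a \<notin> e" for e
  proof -
    obtain v where v: "v \<in> {1..n}" "v \<noteq> a" "v \<noteq> c" "e = {c, v}" "flip a c e = {a, v}"
      by (rule flip_end[OF subsetD[OF G e(1)] e(2,3)])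
    show ?thesis unfolding v(5) unfolding v(4) using v(2,3) ac by simp
  qed
  have le: "\<Sum>(shift_edge a c G e) \<le> \<Sum>e" if e: "e \<in> G" for e
    unfolding shift_edge_def by (simp add: less[OF e] less_imp_le)
  show "(\<Sum>e\<in>shift a c G. \<Sum>e) \<le> (\<Sum>e\<in>G. \<Sum>e)" unfolding S by (rule sum_mono[OF le])
  assume "shift a c G \<noteq> G"
  then obtain e where e: "e \<in> G" "c \<in> e" "a \<notin> e" "flip a c e \<notin> G" by (rule moved_edge)
  then have "\<Sum>(shift_edge a c G e) < \<Sum>e" unfolding shift_edge_def using less[OF e(1-3)] by simp
  then show "(\<Sum>e\<in>shift a c G. \<Sum>e) < (\<Sum>e\<in>G. \<Sum>e)"
    unfolding S using le e(1) fG by (intro sum_strict_mono_ex1) auto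
qed

lemma two_values_cases:
  assumes "\<And>i. i \<in> I \<Longrightarrow> G i = H \<or> G i = H'"
  shows "(\<forall>i\<in>I. G i = H) \<or> (\<forall>i\<in>I. G i = H') \<or>
    (\<exists>p q. p \<in> I \<and> q \<in> I \<and> p \<noteq> q \<and> G p = H \<and> G q = H')"
proof (rule ccontr)
  assume no: "\<not> ?thesis"
  then obtain p q where pq: "p \<in> I" "q \<in> I" "G p \<noteq> H'" "G q \<noteq> H" by blast
  then have "G p = H" "G q = H'" using assms by blast+
  then show False using no pq by metis
qed

section \<open>Mixed families of two exchanged extremal graphs, and reversal of shifts that end in
  one\<close>

context threshold
begin

text \<open>\<open>join_certificate_rigid\<close> asks for a set \<open>K\<close> of size 1 when the
  core has size \<open>m\<close>, so any vertex \<open>w\<close> outside the core serves.\<close>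

lemma star_certificate_rigid:
  assumes C: "C \<subseteq> {1..n}" "card C = m"
    and cert: "spectral_certificate n b (join_graph n C {}) x"
  shows "\<And>u. u \<in> {1..n} \<Longrightarrow> 0 < x u"
    and "\<And>u v. u \<in> C \<Longrightarrow> v \<in> {1..n} - C \<Longrightarrow> x v < x u"
    and "2 * (\<Sum>e\<in>join_graph n C {}. \<Prod>u\<in>e. x u) = b * (\<Sum>u\<in>{1..n}. (x u)\<^sup>2)"
proof -
  have "card C < card {1..n}" using C n_ge by simp
  then obtain w where w: "w \<in> {1..n}" "w \<notin> C"
    by (metis card_mono finite_atLeastAtMost C(1) leD subsetI finite_subset)
  have sub: "join_graph n C {} \<subseteq> join_graph n C {w}" unfolding join_graph_def by auto
  have hyps: "{w} \<subseteq> {1..n}" "C \<inter> {w} = {}" "1 \<le> card C" "card C \<le> m" "card {w} = 2 * m + 1 - 2 * card C"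
    using w C m_pos by auto
  note r = join_certificate_rigid[OF C(1) hyps(1,2,3,4,5) sub cert]
  show "\<And>u. u \<in> {1..n} \<Longrightarrow> 0 < x u" by (rule r(4))
  show "\<And>u v. u \<in> C \<Longrightarrow> v \<in> {1..n} - C \<Longrightarrow> x v < x u" by (rule r(5))
  show "2 * (\<Sum>e\<in>join_graph n C {}. \<Prod>u\<in>e. x u) = b * (\<Sum>u\<in>{1..n}. (x u)\<^sup>2)" by (rule r(6))
qed

text \<open>The two cliques share the \<open>2 * m\<close> vertices of \<open>K - {a}\<close>, split
  into halves \<open>A\<close> and \<open>B\<close>. Members \<open>p\<close> and \<open>q\<close>
  use their private vertices \<open>a\<close> and \<open>c\<close>, each with one vertex of a
  different half; the remaining pairs across the halves lie in both cliques.\<close>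

lemma rainbow_two_cliques:
  assumes K: "K \<subseteq> {1..n}" "card K = 2 * m + 1" and a: "a \<in> K" and c: "c \<in> {1..n}" "c \<notin> K"
    and pq: "p \<in> {1..m+1}" "q \<in> {1..m+1}" "p \<noteq> q"
    and Gp: "G p = join_graph n {} K" and Gq: "G q = join_graph n {} (flip a c K)"
    and G: "\<And>i. i \<in> {1..m+1} \<Longrightarrow> G i = join_graph n {} K \<or> G i = join_graph n {} (flip a c K)"
  shows "has_rainbow_matching (m+1) G"
proof -
  have fK: "finite K" using K(1) finite_subset by blast
  have "card (K - {a}) = 2 * m" using K(2) a fK by simp
  then obtain A where A: "A \<subseteq> K - {a}" "card A = m"
    using obtain_subset_with_card_n[of m "K - {a}"] by auto
  define B where "B = K - {a} - A"
  have fA: "finite A" using A(1) fK finite_subset by blast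
  have B: "card B = m" "finite B" unfolding B_def using A fA fK \<open>card (K - {a}) = 2 * m\<close>
    by (simp_all add: card_Diff_subset)
  obtain u where u: "u \<in> A" using A(2) m_pos by fastforce
  obtain v where v: "v \<in> B" using B m_pos by fastforce
  have AB: "A \<inter> B = {}" unfolding B_def by blast
  have inK: "w \<in> K \<and> w \<in> {1..n} \<and> w \<noteq> a \<and> w \<noteq> c" if "w \<in> A \<union> B" for w
    using that A(1) K(1) c(2) unfolding B_def by blast
  have inF: "w \<in> flip a c K" if "w \<in> A \<union> B" for w
    using inK[OF that] unfolding mem_flip_iff by simp
  have cF: "c \<in> flip a c K" using a by simp
  have ac: "a \<noteq> c" "a \<in> {1..n}" using a c K(1) by auto
  have uv: "u \<noteq> v" using u v AB by blast
  show ?thesis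
  proof (rule rainbow_matching_from_bipartite[OF pq, of "{a, u}" G "{c, v}" "A - {u}" "B - {v}"])
    show "{a, u} \<in> G p" unfolding Gp pair_in_join_graph using a ac inK[of u] u by simp
    show "{c, v} \<in> G q" unfolding Gq pair_in_join_graph using c cF inK[of v] inF[of v] v by simp
    show "{a, u} \<inter> {c, v} = {}" using ac inK[of u] inK[of v] u v uv by auto
    show "finite (A - {u})" "finite (B - {v})" using fA B by auto
    show "m + 1 \<le> card (A - {u}) + 2" "m + 1 \<le> card (B - {v}) + 2" using fA A B u v by auto
    show "(A - {u}) \<inter> (B - {v}) = {}" using AB by blast
    show "(A - {u} \<union> (B - {v})) \<inter> ({a, u} \<union> {c, v}) = {}"
      using inK AB u v by blast
    show "{s, t} \<in> G i" if "i \<in> {1..m+1}" "s \<in> A - {u}" "t \<in> B - {v}" for i s t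
    proof -
      have "s \<noteq> t" using that AB by blast
      moreover have "s \<in> A \<union> B" "t \<in> A \<union> B" using that by auto
      ultimately show ?thesis using G[OF that(1)] inK[of s] inK[of t] inF[of s] inF[of t]
        by (elim disjE) (simp_all add: pair_in_join_graph)
    qed
  qed
qed

text \<open>The two cores share the \<open>m - 1\<close> vertices of \<open>C - {a}\<close>. Members
  \<open>p\<close> and \<open>q\<close> use their private core vertices \<open>a\<close> and
  \<open>c\<close>; the shared core vertices are matched to outside vertices for the others.\<close>

lemma rainbow_two_stars:
  assumes C: "C \<subseteq> {1..n}" "card C = m" and a: "a \<in> C" and c: "c \<in> {1..n}" "c \<notin> C"
    and pq: "p \<in> {1..m+1}" "q \<in> {1..m+1}" "p \<noteq> q"
    and Gp: "G p = join_graph n C {}" and Gq: "G q = join_graph n (flip a c C) {}"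
    and G: "\<And>i. i \<in> {1..m+1} \<Longrightarrow> G i = join_graph n C {} \<or> G i = join_graph n (flip a c C) {}"
  shows "has_rainbow_matching (m+1) G"
proof -
  have fC: "finite C" using C(1) finite_subset by blast
  define W where "W = {1..n} - insert c C"
  have W: "finite W" "card W = n - (m + 1)" unfolding W_def using C c fC
    by (auto simp: card_Diff_subset)
  have "2 \<le> card W" using W n_ge m_pos by simp
  then obtain T where T: "T \<subseteq> W" "card T = 2" by (meson obtain_subset_with_card_n)
  then obtain u v where uv: "u \<in> W" "v \<in> W" "u \<noteq> v" by (auto simp: card_2_iff)
  have inC: "w \<in> {1..n} \<and> w \<in> flip a c C \<and> w \<noteq> c" if "w \<in> C - {a}" for w
  proof -
    have "w \<noteq> a" "w \<noteq> c" "w \<in> C" using that c(2) by auto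
    then show ?thesis using C(1) unfolding mem_flip_iff by auto
  qed
  have inW: "w \<in> {1..n} \<and> w \<notin> C \<and> w \<noteq> a \<and> w \<noteq> c" if "w \<in> W" for w
    using that a unfolding W_def by auto
  have cF: "c \<in> flip a c C" using a by simp
  have ac: "a \<noteq> c" "a \<in> {1..n}" using a c C(1) by auto
  have WC: "W \<inter> C = {}" unfolding W_def by blast
  show ?thesis
  proof (rule rainbow_matching_from_bipartite[OF pq, of "{a, u}" G "{c, v}" "C - {a}" "W - {u, v}"])
    show "{a, u} \<in> G p" unfolding Gp pair_in_join_graph using a ac inW[OF uv(1)] by simp
    show "{c, v} \<in> G q" unfolding Gq pair_in_join_graph using c cF inW[OF uv(2)] by simp
    show "{a, u} \<inter> {c, v} = {}" using ac inW[OF uv(1)] inW[OF uv(2)] uv(3) by simp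
    show "finite (C - {a})" "finite (W - {u, v})" using fC W by auto
    show "m + 1 \<le> card (C - {a}) + 2" using fC C a by simp
    \<comment> \<open>The set has \<open>n - m - 3\<close> elements, so this is exactly
      \<open>2 * m + 2 \<le> n\<close>.\<close>
    show "m + 1 \<le> card (W - {u, v}) + 2" using W uv n_ge by (simp add: card_Diff_subset)
    show "(C - {a}) \<inter> (W - {u, v}) = {}" using WC by blast
    show "(C - {a} \<union> (W - {u, v})) \<inter> ({a, u} \<union> {c, v}) = {}"
      using inW[OF uv(1)] inW[OF uv(2)] inW c(2) by blast
    show "{s, t} \<in> G i" if "i \<in> {1..m+1}" "s \<in> C - {a}" "t \<in> W - {u, v}" for i s t
    proof -
      have "s \<noteq> t" using that WC by blast
      moreover have "t \<in> W" using that by simp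
      ultimately show ?thesis using G[OF that(1)] inC[OF that(2)] inW[of t] that(2)
        by (elim disjE) (simp_all add: pair_in_join_graph)
    qed
  qed
qed

text \<open>If the exchange fixes \<open>K\<close>, \<open>unshift_twins\<close> applies. Otherwise
  a certificate is positive on one of \<open>a\<close>, \<open>c\<close> and zero on the other, so
  by \<open>unshift_rigid\<close> each member is one of two cliques. A family containing both has a
  rainbow matching.\<close>

lemma unshift_cliques:
  assumes graphs: "\<And>i. i \<in> {1..m+1} \<Longrightarrow> G i \<subseteq> all_pairs n"
    and certs: "\<And>i. i \<in> {1..m+1} \<Longrightarrow> \<exists>x. spectral_certificate n b (G i) x"
    and ac: "a \<in> {1..n}" "c \<in> {1..n}" and no: "\<not> has_rainbow_matching (m+1) G"
    and K: "K \<subseteq> {1..n}" "card K = 2 * m + 1"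
    and H: "\<And>i. i \<in> {1..m+1} \<Longrightarrow> shift a c (G i) = join_graph n {} K"
  shows "\<exists>L\<subseteq>{1..n}. card L = 2 * m + 1 \<and> (\<forall>i\<in>{1..m+1}. G i = join_graph n {} L)"
proof (cases "c \<in> K \<longleftrightarrow> a \<in> K")
  case True
  have "flip a c ` join_graph n {} K = join_graph n {} K"
    unfolding flip_image_join_graph[OF ac] flip_empty flip_eq_self[OF True] ..
  then have "G i = join_graph n {} K" if "i \<in> {1..m+1}" for i
    by (rule unshift_twins[OF H[OF that]])
  then show ?thesis using K by blast
next
  case False
  note r = clique_certificate_rigid[OF K subset_refl]
  have two: "G i = join_graph n {} K \<or> G i = join_graph n {} (flip a c K)" if i: "i \<in> {1..m+1}" for i
  proof -
    obtain x where x: "spectral_certificate n b (G i) x" using certs[OF i] by blast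
    have "G i = join_graph n {} K \<or> G i = flip a c ` join_graph n {} K"
    proof (rule unshift_rigid[OF graphs[OF i] x ac H[OF i]])
      fix z v assume z: "spectral_certificate n b (join_graph n {} K) z"
      show "2 * (\<Sum>e\<in>join_graph n {} K. \<Prod>u\<in>e. z u) = b * (\<Sum>u\<in>{1..n}. (z u)\<^sup>2)" by (rule r(5)[OF z])
      show "z a \<noteq> z c" using False r(3)[OF z, of a] r(3)[OF z, of c] r(4)[OF z, of a] r(4)[OF z, of c] ac
        by (cases "a \<in> K") auto
      show "z v \<noteq> 0" if "{a, v} \<in> join_graph n {} K"
        using that r(3)[OF z, of v] unfolding pair_in_join_graph by auto
    qed
    then show ?thesis unfolding flip_image_join_graph[OF ac] flip_empty .
  qed
  have F: "flip a c K \<subseteq> {1..n}" "card (flip a c K) = 2 * m + 1"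
    using flip_subset[OF K(1) ac] card_flip K(2) by auto
  consider (1) "\<forall>i\<in>{1..m+1}. G i = join_graph n {} K" | (2) "\<forall>i\<in>{1..m+1}. G i = join_graph n {} (flip a c K)"
    | (3) p q where "p \<in> {1..m+1}" "q \<in> {1..m+1}" "p \<noteq> q" "G p = join_graph n {} K" "G q = join_graph n {} (flip a c K)"
    using two_values_cases[of "{1..m+1}" G, OF two] by metis
  then show ?thesis
  proof cases
    case 1 then show ?thesis using K by blast
  next
    case 2 then show ?thesis using F by blast
  next
    case (3 p q)
    have "has_rainbow_matching (m+1) G"
    proof (cases "a \<in> K")
      case True
      then have "c \<notin> K" using False by blast
      show ?thesis by (rule rainbow_two_cliques[where G = G, OF K True ac(2) \<open>c \<notin> K\<close> 3]) (rule two)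
    next
      case a: False
      then have c: "c \<in> K" using False by blast
      \<comment> \<open>The roles of \<open>a\<close> and \<open>c\<close> are interchanged, which
        leaves \<open>flip\<close> the same.\<close>
      note rainbow = rainbow_two_cliques[where G = G, OF K c ac(1) a 3(1-4), unfolded flip_commute[of c a], OF 3(5)]
      show ?thesis by (rule rainbow) (rule two)
    qed
    then show ?thesis using no by blast
  qed
qed

text \<open>As for cliques, except that \<open>a\<close> and \<open>c\<close> are now told apart by
  the strict drop of certificates outside the core.\<close>

lemma unshift_stars:
  assumes graphs: "\<And>i. i \<in> {1..m+1} \<Longrightarrow> G i \<subseteq> all_pairs n"
    and certs: "\<And>i. i \<in> {1..m+1} \<Longrightarrow> \<exists>x. spectral_certificate n b (G i) x"
    and ac: "a \<in> {1..n}" "c \<in> {1..n}" and no: "\<not> has_rainbow_matching (m+1) G"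
    and C: "C \<subseteq> {1..n}" "card C = m"
    and H: "\<And>i. i \<in> {1..m+1} \<Longrightarrow> shift a c (G i) = join_graph n C {}"
  shows "\<exists>L\<subseteq>{1..n}. card L = m \<and> (\<forall>i\<in>{1..m+1}. G i = join_graph n L {})"
proof (cases "c \<in> C \<longleftrightarrow> a \<in> C")
  case True
  have "flip a c ` join_graph n C {} = join_graph n C {}"
    unfolding flip_image_join_graph[OF ac] flip_empty flip_eq_self[OF True] ..
  then have "G i = join_graph n C {}" if "i \<in> {1..m+1}" for i
    by (rule unshift_twins[OF H[OF that]])
  then show ?thesis using C by blast
next
  case False
  note r = star_certificate_rigid[OF C]
  have two: "G i = join_graph n C {} \<or> G i = join_graph n (flip a c C) {}" if i: "i \<in> {1..m+1}" for i
  proof -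
    obtain x where x: "spectral_certificate n b (G i) x" using certs[OF i] by blast
    have "G i = join_graph n C {} \<or> G i = flip a c ` join_graph n C {}"
    proof (rule unshift_rigid[OF graphs[OF i] x ac H[OF i]])
      fix z v assume z: "spectral_certificate n b (join_graph n C {}) z"
      show "2 * (\<Sum>e\<in>join_graph n C {}. \<Prod>u\<in>e. z u) = b * (\<Sum>u\<in>{1..n}. (z u)\<^sup>2)" by (rule r(3)[OF z])
      show "z a \<noteq> z c" using False r(2)[OF z, of a c] r(2)[OF z, of c a] ac
        by (cases "a \<in> C") auto
      show "z v \<noteq> 0" if "{a, v} \<in> join_graph n C {}"
        using that r(1)[OF z, of v] unfolding pair_in_join_graph by auto
    qed
    then show ?thesis unfolding flip_image_join_graph[OF ac] flip_empty .
  qed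
  have F: "flip a c C \<subseteq> {1..n}" "card (flip a c C) = m"
    using flip_subset[OF C(1) ac] card_flip C(2) by auto
  consider (1) "\<forall>i\<in>{1..m+1}. G i = join_graph n C {}" | (2) "\<forall>i\<in>{1..m+1}. G i = join_graph n (flip a c C) {}"
    | (3) p q where "p \<in> {1..m+1}" "q \<in> {1..m+1}" "p \<noteq> q" "G p = join_graph n C {}" "G q = join_graph n (flip a c C) {}"
    using two_values_cases[of "{1..m+1}" G, OF two] by metis
  then show ?thesis
  proof cases
    case 1 then show ?thesis using C by blast
  next
    case 2 then show ?thesis using F by blast
  next
    case (3 p q)
    have "has_rainbow_matching (m+1) G"
    proof (cases "a \<in> C")
      case True
      then have "c \<notin> C" using False by blast
      show ?thesis by (rule rainbow_two_stars[where G = G, OF C True ac(2) \<open>c \<notin> C\<close> 3]) (rule two)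
    next
      case a: False
      then have c: "c \<in> C" using False by blast
      note rainbow = rainbow_two_stars[where G = G, OF C c ac(1) a 3(1-4), unfolded flip_commute[of c a], OF 3(5)]
      show ?thesis by (rule rainbow) (rule two)
    qed
    then show ?thesis using no by blast
  qed
qed

end

subsection \<open>Stable families\<close>

text \<open>For \<open>i\<close> from 1 to \<open>m + 1\<close> these nested pairs partition
  \<open>{1..2 * m + 2}\<close>. When \<open>2 * m + 2 \<le> n\<close>, the graph
  \<open>A_graph i n m\<close> contains all of them except the one with index
  \<open>i\<close>.\<close>

definition rainbow_pair :: "nat \<Rightarrow> nat \<Rightarrow> nat set" where
  "rainbow_pair m i = {i, 2 * m + 3 - i}"

lemma rainbow_pair_disjoint:
  assumes "i \<in> {1..m+1}" "j \<in> {1..m+1}" "i \<noteq> j"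
  shows "rainbow_pair m i \<inter> rainbow_pair m j = {}"
  using assms unfolding rainbow_pair_def by auto

lemma stable_flip:
  assumes st: "shift a c G = G" and e: "e \<in> G" "c \<in> e" "a \<notin> e"
  shows "flip a c e \<in> G"
proof -
  have "e \<in> shift a c G" using st e by simp
  then show ?thesis using e unfolding mem_shift by simp
qed

lemma A_graph_eq_join_graph:
  "A_graph i n m = join_graph n {1..i - 1} ({1..2 * m + 2 - i} - {1..i - 1})"
  unfolding A_graph_def join_graph_def ..

text \<open>An edge outside \<open>A_graph i n m\<close> has its smaller end at least
  \<open>i\<close> and its larger end at least \<open>2 * m + 3 - i\<close>. Stability allows
  lowering first one end and then the other, which produces the missing pair.\<close>

lemma stable_subset_A_graph:
  assumes G: "G \<subseteq> all_pairs n" and n: "2 * m + 2 \<le> n"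
    and st: "\<And>a c. 1 \<le> a \<Longrightarrow> a < c \<Longrightarrow> c \<le> n \<Longrightarrow> shift a c G = G"
    and i: "i \<in> {1..m+1}" and miss: "rainbow_pair m i \<notin> G"
  shows "G \<subseteq> A_graph i n m"
proof (rule subsetI, rule ccontr)
  fix e assume e: "e \<in> G" "e \<notin> A_graph i n m"
  obtain u v where uv: "e = {u, v}" "u < v" "u \<in> {1..n}" "v \<in> {1..n}"
    by (rule all_pairs_cases[OF subsetD[OF G e(1)]])
  define j where "j = 2 * m + 3 - i"
  have ij: "1 \<le> i" "i < j" "i \<le> u" "j \<le> v"
  proof -
    show "1 \<le> i" "i < j" using i unfolding j_def by auto
    have nj: "{u, v} \<notin> join_graph n {1..i - 1} ({1..2 * m + 2 - i} - {1..i - 1})"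
      using e(2) unfolding uv(1) A_graph_eq_join_graph .
    show iu: "i \<le> u" using nj uv(2-4) unfolding pair_in_join_graph by auto
    show "j \<le> v" using nj uv(2-4) iu i unfolding pair_in_join_graph j_def by auto
  qed
  have iv: "{i, v} \<in> G"
  proof (cases "i = u")
    case True then show ?thesis using e uv by simp
  next
    case False
    then have "i < u" using ij by simp
    have "flip i u {u, v} \<in> G"
      using uv(1,2,3) e(1) ij \<open>i < u\<close> by (intro stable_flip[OF st]) auto
    then show ?thesis using flip_pair[of v i u] uv(2) \<open>i < u\<close> by simp
  qed
  have "{i, j} \<in> G"
  proof (cases "j = v")
    case True then show ?thesis using iv by simp
  next
    case False
    then have "j < v" using ij by simp
    have "flip j v {v, i} \<in> G"
      using uv(4) iv ij \<open>j < v\<close> by (intro stable_flip[OF st]) (auto simp: insert_commute)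
    then show ?thesis using flip_pair[of i j v] ij \<open>j < v\<close> by (simp add: insert_commute)
  qed
  then show False using miss unfolding rainbow_pair_def j_def by simp
qed

section \<open>Stable families, and the reduction of all families to them\<close>

context threshold
begin

text \<open>As \<open>b\<close> is positive, this says that \<open>b\<close> is the spectral radius
  of \<open>A_graph (m + 1) n m\<close>.\<close>

abbreviation tight_star :: bool where
  "tight_star \<equiv> (real m - 1) * b + real m * (real n - real m) = b\<^sup>2"

text \<open>Here and in \<open>all_star\<close> the equality satisfied by \<open>b\<close> is
  recorded along with the structure, because it later decides how \<open>n\<close> compares with
  \<open>3 * m + 2\<close>.\<close>

definition all_clique :: "(nat \<Rightarrow> nat set set) \<Rightarrow> bool" where
  "all_clique G \<longleftrightarrow> b = 2 * real m \<and>
     (\<exists>K\<subseteq>{1..n}. card K = 2 * m + 1 \<and> (\<forall>i\<in>{1..m+1}. G i = join_graph n {} K))"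

definition all_star :: "(nat \<Rightarrow> nat set set) \<Rightarrow> bool" where
  "all_star G \<longleftrightarrow> tight_star \<and>
     (\<exists>C\<subseteq>{1..n}. card C = m \<and> (\<forall>i\<in>{1..m+1}. G i = join_graph n C {}))"

text \<open>The enclosing \<open>A_graph i n m\<close> is a clique for \<open>i = 1\<close> and
  otherwise a join with core size \<open>i - 1\<close>. Rigidity only admits core size
  \<open>m\<close>, so intermediate \<open>i\<close> cannot occur.\<close>

lemma stable_missing_pair:
  assumes G: "G \<subseteq> all_pairs n" and cert: "spectral_certificate n b G x"
    and st: "\<And>a c. 1 \<le> a \<Longrightarrow> a < c \<Longrightarrow> c \<le> n \<Longrightarrow> shift a c G = G"
    and i: "i \<in> {1..m+1}" and miss: "rainbow_pair m i \<notin> G"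
  shows "i = 1 \<and> b = 2 * real m \<and> G = join_graph n {} {1..2 * m + 1} \<or>
         i = m + 1 \<and> tight_star \<and> G = join_graph n {1..m} {}"
proof -
  have sub: "G \<subseteq> join_graph n {1..i - 1} ({1..2 * m + 2 - i} - {1..i - 1})"
    using stable_subset_A_graph[OF G n_ge st i miss] unfolding A_graph_eq_join_graph .
  show ?thesis
  proof (cases "i = 1")
    case True
    have "G \<subseteq> join_graph n {} {1..2 * m + 1}" using sub True by simp
    moreover have "{1..2 * m + 1} \<subseteq> {1..n}" "card {1..2 * m + 1} = 2 * m + 1" using n_ge by auto
    ultimately show ?thesis using clique_certificate_rigid(1,2)[OF _ _ _ cert] True by blast
  next
    case False
    define C where "C = {1..i - 1}"
    define K where "K = {1..2 * m + 2 - i} - C"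
    have C: "card C = i - 1" unfolding C_def by simp
    have CK: "C \<subseteq> {1..n}" "K \<subseteq> {1..n}" "C \<inter> K = {}" "1 \<le> card C" "card C \<le> m"
      "card K = 2 * m + 1 - 2 * card C"
    proof -
      show "C \<subseteq> {1..n}" "K \<subseteq> {1..n}" "1 \<le> card C" "card C \<le> m"
        using i n_ge False unfolding K_def C_def by auto
      show "C \<inter> K = {}" unfolding K_def by blast
      have "C \<subseteq> {1..2 * m + 2 - i}" using i unfolding C_def by auto
      then show "card K = 2 * m + 1 - 2 * card C" unfolding K_def using i C
        by (subst card_Diff_subset) (auto simp: C_def)
    qed
    note r = join_certificate_rigid[OF CK sub[folded C_def, folded K_def] cert]
    have "i = card C + 1" using C i by simp
    then have im: "i = m + 1" using r(1) by simp
    have K: "K = {m + 1}" unfolding K_def C_def im by auto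
    \<comment> \<open>A singleton contains no pair, so as the set \<open>K\<close> it contributes no
      edge.\<close>
    have "join_graph n C {m + 1} = join_graph n C {}"
    proof (rule antisym)
      show "join_graph n C {m + 1} \<subseteq> join_graph n C {}"
      proof
        fix e assume "e \<in> join_graph n C {m + 1}"
        then have e: "e \<in> all_pairs n" "e \<inter> C \<noteq> {} \<or> e \<subseteq> {m + 1}" unfolding join_graph_def by auto
        have "\<not> e \<subseteq> {m + 1}"
        proof
          assume "e \<subseteq> {m + 1}"
          then have "card e \<le> 1" using card_mono[of "{m + 1}" e] by simp
          then show False using e(1) unfolding all_pairs_def by simp
        qed
        then show "e \<in> join_graph n C {}" using e unfolding join_graph_def by simp
      qed
    qed (auto simp: join_graph_def)
    then show ?thesis using im r(2,3) unfolding K by (simp add: C_def)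
  qed
qed

text \<open>Only the pairs with index 1 and \<open>m + 1\<close> can be missing anywhere, and a pair
  missing from every member makes all members the same extremal graph. Otherwise these two pairs go
  to two different members containing them, and the rest can be distributed arbitrarily.\<close>

lemma stable_family:
  assumes graphs: "\<And>i. i \<in> {1..m+1} \<Longrightarrow> G i \<subseteq> all_pairs n"
    and certs: "\<And>i. i \<in> {1..m+1} \<Longrightarrow> \<exists>x. spectral_certificate n b (G i) x"
    and st: "\<And>i a c. i \<in> {1..m+1} \<Longrightarrow> 1 \<le> a \<Longrightarrow> a < c \<Longrightarrow> c \<le> n \<Longrightarrow> shift a c (G i) = G i"
    and no: "\<not> has_rainbow_matching (m+1) G"
  shows "all_clique G \<or> all_star G"
proof (rule ccontr)
  assume contr: "\<not> ?thesis"
  define E where "E = rainbow_pair m"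
  let ?I = "{1..m+1}"
  have miss: "i = 1 \<and> b = 2 * real m \<and> G j = join_graph n {} {1..2 * m + 1} \<or>
         i = m + 1 \<and> tight_star \<and> G j = join_graph n {1..m} {}"
    if i: "i \<in> ?I" and j: "j \<in> ?I" and e: "E i \<notin> G j" for i j
  proof -
    obtain x where x: "spectral_certificate n b (G j) x" using certs[OF j] by blast
    show ?thesis by (rule stable_missing_pair[OF graphs[OF j] x st[OF j] i e[unfolded E_def]])
  qed
  have I1: "1 \<in> ?I" "m + 1 \<in> ?I" "m + 1 \<noteq> 1" using m_pos by auto
  have "\<exists>q\<in>?I. E 1 \<in> G q"
  proof (rule ccontr)
    assume "\<not> ?thesis"
    then have "b = 2 * real m \<and> G j = join_graph n {} {1..2 * m + 1}" if "j \<in> ?I" for j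
      using miss[OF I1(1) that] that I1(3) by metis
    moreover have "{1..2 * m + 1} \<subseteq> {1..n}" "card {1..2 * m + 1} = 2 * m + 1" using n_ge by auto
    ultimately have "all_clique G" unfolding all_clique_def using I1(1) by blast
    then show False using contr by blast
  qed
  then obtain q0 where q0: "q0 \<in> ?I" "E 1 \<in> G q0" by blast
  have "\<exists>p\<in>?I. E (m + 1) \<in> G p"
  proof (rule ccontr)
    assume "\<not> ?thesis"
    then have "tight_star \<and> G j = join_graph n {1..m} {}" if "j \<in> ?I" for j
      using miss[OF I1(2) that] that I1(3) by metis
    moreover have "{1..m} \<subseteq> {1..n}" "card {1..m} = m" using n_ge by auto
    ultimately have "all_star G" unfolding all_star_def using I1(1) by blast
    then show False using contr by blast
  qed
  then obtain p0 where p0: "p0 \<in> ?I" "E (m + 1) \<in> G p0" by blast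
  obtain p q where pq: "p \<in> ?I" "q \<in> ?I" "p \<noteq> q" "E (m + 1) \<in> G p" "E 1 \<in> G q"
  proof (cases "p0 = q0")
    case False then show ?thesis using that p0 q0 by blast
  next
    case True
    \<comment> \<open>One member holds both critical pairs, so a second member \<open>r\<close> must
      take over one. If it lacks the pair with index 1, it is the clique on
      \<open>{1..2 * m + 1}\<close>, which contains \<open>{m + 1, m + 2}\<close>.\<close>
    obtain r where r: "r \<in> ?I" "r \<noteq> q0" using I1 by metis
    show ?thesis
    proof (cases "E 1 \<in> G r")
      case True then show ?thesis using that[of p0 r] p0 q0 r \<open>p0 = q0\<close> by simp
    next
      case False
      then have "G r = join_graph n {} {1..2 * m + 1}" using miss[OF I1(1) r(1)] I1(3) by simp
      then have "E (m + 1) \<in> G r"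
        using m_pos n_ge unfolding E_def rainbow_pair_def by (simp add: pair_in_join_graph)
      then show ?thesis using that[of r q0] r q0 by simp
    qed
  qed
  \<comment> \<open>\<open>\<sigma>\<close> composes two exchanges: the first sends \<open>q\<close>
    to 1 and \<open>p\<close> to \<open>p'\<close>, the second sends \<open>p'\<close> to
    \<open>m + 1\<close> and fixes 1.\<close>
  define p' where "p' = transpose q 1 p"
  define \<sigma> where "\<sigma> j = transpose p' (m + 1) (transpose q 1 j)" for j
  have p': "p' \<noteq> 1" unfolding p'_def using pq(3) by (auto simp: transpose_def)
  have p'I: "p' \<in> ?I" unfolding p'_def using pq I1 by (auto simp: transpose_def)
  have \<sigma>I: "\<sigma> j \<in> ?I" if "j \<in> ?I" for j
    unfolding \<sigma>_def using that p'I pq I1 by (auto simp: transpose_def)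
  have \<sigma>q: "\<sigma> q = 1" unfolding \<sigma>_def using p' I1(3) by (simp add: transpose_def)
  have \<sigma>p: "\<sigma> p = m + 1" unfolding \<sigma>_def p'_def[symmetric] by simp
  have inj: "\<sigma> i \<noteq> \<sigma> j" if "i \<noteq> j" for i j
    unfolding \<sigma>_def using that by (simp add: inj_eq[OF inj_transpose])
  have "E (\<sigma> j) \<in> G j" if j: "j \<in> ?I" for j
  proof (rule ccontr)
    assume "E (\<sigma> j) \<notin> G j"
    then have "\<sigma> j = 1 \<or> \<sigma> j = m + 1" using miss[OF \<sigma>I[OF j] j] by blast
    then have "j = p \<or> j = q" using inj \<sigma>p \<sigma>q by metis
    then show False using \<open>E (\<sigma> j) \<notin> G j\<close> pq \<sigma>p \<sigma>q by auto
  qed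
  moreover have "E (\<sigma> i) \<inter> E (\<sigma> j) = {}" if "i \<in> ?I" "j \<in> ?I" "i \<noteq> j" for i j
    unfolding E_def by (rule rainbow_pair_disjoint[OF \<sigma>I \<sigma>I inj]) (use that in auto)
  ultimately have "has_rainbow_matching (m+1) G" unfolding has_rainbow_matching_def
    by (intro exI[of _ "\<lambda>j. E (\<sigma> j)"] conjI ballI impI)
  then show False using no by blast
qed

text \<open>One and the same shift is applied to all members. It preserves the hypotheses and lowers
  the total label sum as soon as one member changes; the resulting structure is carried back by
  \<open>unshift_cliques\<close> or \<open>unshift_stars\<close>.\<close>

theorem no_rainbow_structure:
  assumes graphs: "\<And>i. i \<in> {1..m+1} \<Longrightarrow> G i \<subseteq> all_pairs n"
    and certs: "\<And>i. i \<in> {1..m+1} \<Longrightarrow> \<exists>x. spectral_certificate n b (G i) x"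
    and no: "\<not> has_rainbow_matching (m+1) G"
  shows "all_clique G \<or> all_star G"
  using assms
proof (induction "\<Sum>i\<in>{1..m+1}. \<Sum>e\<in>G i. \<Sum>e" arbitrary: G rule: less_induct)
  case less
  let ?I = "{1..m+1}"
  show ?case
  proof (cases "\<forall>i\<in>?I. \<forall>a c. 1 \<le> a \<longrightarrow> a < c \<longrightarrow> c \<le> n \<longrightarrow> shift a c (G i) = G i")
    case True
    show ?thesis
    proof (rule stable_family)
      show "shift a c (G i) = G i" if "i \<in> ?I" "1 \<le> a" "a < c" "c \<le> n" for i a c using True that by blast
    qed (use less.prems in blast)+
  next
    case False
    then obtain j a c where j: "j \<in> ?I" "1 \<le> a" "a < c" "c \<le> n" "shift a c (G j) \<noteq> G j" by blast
    have ac: "a \<in> {1..n}" "c \<in> {1..n}" using j by auto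
    define F where "F i = shift a c (G i)" for i
    have "(\<Sum>i\<in>?I. \<Sum>e\<in>F i. \<Sum>e) < (\<Sum>i\<in>?I. \<Sum>e\<in>G i. \<Sum>e)"
    proof (rule sum_strict_mono_ex1)
      show "\<forall>i\<in>?I. (\<Sum>e\<in>F i. \<Sum>e) \<le> (\<Sum>e\<in>G i. \<Sum>e)"
        unfolding F_def using shift_weight(1)[OF less.prems(1) j(3)] by blast
      show "\<exists>i\<in>?I. (\<Sum>e\<in>F i. \<Sum>e) < (\<Sum>e\<in>G i. \<Sum>e)"
        unfolding F_def using shift_weight(2)[OF less.prems(1)[OF j(1)] j(3) j(5)] j(1) by blast
    qed simp
    moreover have "F i \<subseteq> all_pairs n" if "i \<in> ?I" for i
      unfolding F_def by (rule shift_all_pairs[OF less.prems(1)[OF that] ac])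
    moreover have "\<exists>x. spectral_certificate n b (F i) x" if i: "i \<in> ?I" for i
      unfolding F_def using less.prems(2)[OF i] certificate_shift[OF less.prems(1)[OF i] _ ac] by metis
    moreover have "\<not> has_rainbow_matching (m+1) F"
      unfolding F_def using less.prems(3) has_rainbow_matching_shift by metis
    ultimately have "all_clique F \<or> all_star F" by (rule less.hyps)
    then show ?thesis
    proof
      assume "all_clique F"
      then obtain K where K: "b = 2 * real m" "K \<subseteq> {1..n}" "card K = 2 * m + 1"
        "\<forall>i\<in>?I. F i = join_graph n {} K" unfolding all_clique_def by blast
      have "\<exists>L\<subseteq>{1..n}. card L = 2 * m + 1 \<and> (\<forall>i\<in>?I. G i = join_graph n {} L)"
      proof (rule unshift_cliques[OF _ _ ac less.prems(3) K(2,3)])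
        show "shift a c (G i) = join_graph n {} K" if "i \<in> ?I" for i using K(4) that unfolding F_def by blast
      qed (use less.prems in blast)+
      then show ?thesis using K(1) unfolding all_clique_def by blast
    next
      assume "all_star F"
      then obtain C where C: tight_star "C \<subseteq> {1..n}" "card C = m"
        "\<forall>i\<in>?I. F i = join_graph n C {}" unfolding all_star_def by blast
      have "\<exists>L\<subseteq>{1..n}. card L = m \<and> (\<forall>i\<in>?I. G i = join_graph n L {})"
      proof (rule unshift_stars[OF _ _ ac less.prems(3) C(2,3)])
        show "shift a c (G i) = join_graph n C {}" if "i \<in> ?I" for i using C(4) that unfolding F_def by blast
      qed (use less.prems in blast)+
      then show ?thesis using C(1) unfolding all_star_def by blast
    qed
  qed
qed

end

subsection \<open>Adjacency matrices and isomorphism\<close>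

text \<open>This makes the set under the maximum in \<open>graph_spectral_radius\<close> nonempty.
  For a complex eigenvector the Hermitian form \<open>S\<close> is its own conjugate by symmetry, so
  the eigenvalue is real. The real and imaginary parts then both solve the eigenvalue equation, and
  one of them is nonzero.\<close>

lemma symmetric_real_eigenvalue:
  fixes A :: "real mat"
  assumes A: "A \<in> carrier_mat n n" and n: "0 < n"
    and sym: "\<And>i j. i < n \<Longrightarrow> j < n \<Longrightarrow> A $$ (i, j) = A $$ (j, i)"
  shows "\<exists>k. eigenvalue A k"
proof -
  define B where "B = map_mat complex_of_real A"
  have B: "B \<in> carrier_mat n n" unfolding B_def using A by simp
  obtain k where "eigenvalue B k" using spectrum_non_empty[OF B n] unfolding spectrum_def by auto
  then obtain v where v: "v \<in> carrier_vec n" "v \<noteq> 0\<^sub>v n" "B *\<^sub>v v = k \<cdot>\<^sub>v v"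
    using B unfolding eigenvalue_def eigenvector_def by auto
  have ev: "(\<Sum>j\<in>{0..<n}. of_real (A $$ (i, j)) * v $ j) = k * v $ i" if "i < n" for i
  proof -
    have "(B *\<^sub>v v) $ i = (\<Sum>j\<in>{0..<n}. of_real (A $$ (i, j)) * v $ j)"
      using that v(1) A by (auto simp: B_def scalar_prod_def intro!: sum.cong)
    then show ?thesis using v(1,3) that by simp
  qed
  define N where "N = (\<Sum>i\<in>{0..<n}. (cmod (v $ i))\<^sup>2)"
  define S where "S = (\<Sum>i\<in>{0..<n}. \<Sum>j\<in>{0..<n}. of_real (A $$ (i, j)) * (cnj (v $ i) * v $ j))"
  have S: "S = k * of_real N"
  proof -
    have "S = (\<Sum>i\<in>{0..<n}. cnj (v $ i) * (\<Sum>j\<in>{0..<n}. of_real (A $$ (i, j)) * v $ j))"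
      unfolding S_def by (simp add: sum_distrib_left mult_ac)
    also have "\<dots> = (\<Sum>i\<in>{0..<n}. k * of_real ((cmod (v $ i))\<^sup>2))"
    proof (rule sum.cong)
      fix i assume "i \<in> {0..<n}"
      then have i: "i < n" by simp
      show "cnj (v $ i) * (\<Sum>j\<in>{0..<n}. of_real (A $$ (i, j)) * v $ j) = k * of_real ((cmod (v $ i))\<^sup>2)"
        unfolding ev[OF i] complex_norm_square by (simp add: mult_ac)
    qed simp
    finally show ?thesis unfolding N_def by (simp add: sum_distrib_left)
  qed
  have "cnj S = (\<Sum>i\<in>{0..<n}. \<Sum>j\<in>{0..<n}. of_real (A $$ (i, j)) * (v $ i * cnj (v $ j)))"
    unfolding S_def by (simp add: cnj_sum)
  also have "\<dots> = (\<Sum>j\<in>{0..<n}. \<Sum>i\<in>{0..<n}. of_real (A $$ (i, j)) * (v $ i * cnj (v $ j)))"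
    by (rule sum.swap)
  also have "\<dots> = S" unfolding S_def
    by (intro sum.cong refl) (simp add: sym mult.commute)
  finally have "cnj S = S" .
  obtain l where l: "l < n" "v $ l \<noteq> 0"
    using v(1,2) by (metis carrier_vecD eq_vecI index_zero_vec)
  have "N \<noteq> 0"
  proof
    assume "N = 0"
    then have "(cmod (v $ l))\<^sup>2 = 0" unfolding N_def
      using l(1) by (subst (asm) sum_nonneg_eq_0_iff) auto
    then show False using l(2) by simp
  qed
  then have "cnj k = k" using \<open>cnj S = S\<close> unfolding S by simp
  then obtain r where k: "k = complex_of_real r" by (metis Reals_cnj_iff Reals_cases)
  have real_ev: "eigenvalue A r" if f: "\<And>i. i < n \<Longrightarrow> (\<Sum>j\<in>{0..<n}. A $$ (i, j) * f j) = r * f i"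
    and nz: "f l \<noteq> 0" for f
  proof -
    have "A *\<^sub>v vec n f = r \<cdot>\<^sub>v vec n f"
    proof (rule eq_vecI)
      fix i assume "i < dim_vec (r \<cdot>\<^sub>v vec n f)"
      then have i: "i < n" by simp
      have "(A *\<^sub>v vec n f) $ i = (\<Sum>j\<in>{0..<n}. A $$ (i, j) * f j)"
        using i A by (auto simp: scalar_prod_def intro!: sum.cong)
      then show "(A *\<^sub>v vec n f) $ i = (r \<cdot>\<^sub>v vec n f) $ i" using f[OF i] i by simp
    qed (use A in simp)
    moreover have "vec n f \<noteq> 0\<^sub>v n" using nz l(1) by (metis index_vec index_zero_vec(1))
    ultimately show ?thesis unfolding eigenvalue_def eigenvector_def using A
      by (intro exI[of _ "vec n f"]) auto
  qed
  show ?thesis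
  proof (cases "Re (v $ l) = 0")
    case True
    then have "Im (v $ l) \<noteq> 0" using l(2) by (simp add: complex_eq_iff)
    moreover have "(\<Sum>j\<in>{0..<n}. A $$ (i, j) * Im (v $ j)) = r * Im (v $ i)" if "i < n" for i
      using arg_cong[OF ev[OF that], of Im] by (simp add: k)
    ultimately show ?thesis using real_ev[of "\<lambda>j. Im (v $ j)"] by blast
  next
    case False
    moreover have "(\<Sum>j\<in>{0..<n}. A $$ (i, j) * Re (v $ j)) = r * Re (v $ i)" if "i < n" for i
      using arg_cong[OF ev[OF that], of Re] by (simp add: k)
    ultimately show ?thesis using real_ev[of "\<lambda>j. Re (v $ j)"] by blast
  qed
qed

text \<open>The entries of the matrix are nonnegative, so taking absolute values in an eigenvector
  for the largest eigenvalue keeps the norm and does not decrease the form.\<close>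

lemma spectral_certificate_exists:
  assumes G: "G \<subseteq> all_pairs n" and n: "0 < n" and b: "b \<le> graph_spectral_radius n G"
  shows "\<exists>x. spectral_certificate n b G x"
proof -
  define A where "A = adjacency_matrix n G"
  have A: "A \<in> carrier_mat n n" unfolding A_def adjacency_matrix_def by simp
  have Aij: "A $$ (i, j) = (if {Suc i, Suc j} \<in> G then 1 else 0)" if "i < n" "j < n" for i j
    using that unfolding A_def adjacency_matrix_def by simp
  have "\<exists>k. eigenvalue A k"
    by (rule symmetric_real_eigenvalue[OF A n]) (simp add: Aij insert_commute)
  moreover have "finite {k. eigenvalue A k}"
    using card_finite_spectrum(1)[OF A] unfolding spectrum_def by simp
  ultimately have "eigenvalue A (Max {k. eigenvalue A k})"
    using Max_in[of "{k. eigenvalue A k}"] by auto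
  then obtain k where k: "eigenvalue A k" "b \<le> k"
    using b unfolding graph_spectral_radius_def A_def by blast
  obtain v where v: "v \<in> carrier_vec n" "v \<noteq> 0\<^sub>v n" "A *\<^sub>v v = k \<cdot>\<^sub>v v"
    using A k(1) unfolding eigenvalue_def eigenvector_def by auto
  have ev: "(\<Sum>j<n. A $$ (i, j) * v $ j) = k * v $ i" if "i < n" for i
  proof -
    have "(A *\<^sub>v v) $ i = (\<Sum>j<n. A $$ (i, j) * v $ j)"
      using that v(1) A by (auto simp: scalar_prod_def lessThan_atLeast0 intro!: sum.cong)
    then show ?thesis using v(1,3) that by simp
  qed
  \<comment> \<open>Vertex \<open>u\<close> has matrix index \<open>u - 1\<close>.\<close>
  define x where "x u = \<bar>v $ (u - 1)\<bar>" for u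
  have norm: "(\<Sum>u\<in>{1..n}. (x u)\<^sup>2) = (\<Sum>i<n. (v $ i)\<^sup>2)"
    unfolding x_def by (simp add: sum.atLeast1_atMost_eq)
  have form: "2 * (\<Sum>e\<in>G. \<Prod>u\<in>e. x u) = (\<Sum>i<n. \<Sum>j<n. A $$ (i, j) * (\<bar>v $ i\<bar> * \<bar>v $ j\<bar>))"
  proof -
    have "2 * (\<Sum>e\<in>G. \<Prod>u\<in>e. x u) = (\<Sum>(u,w)\<in>{(u,w). {u,w} \<in> G}. \<Prod>z\<in>{u,w}. x z)"
      using sum_darts_edges[OF G, of "\<lambda>e. \<Prod>u\<in>e. x u"] by simp
    also have "\<dots> = (\<Sum>u\<in>{1..n}. \<Sum>w\<in>nbhd n G u. \<Prod>z\<in>{u,w}. x z)" by (rule sum_darts[OF G])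
    also have "\<dots> = (\<Sum>u\<in>{1..n}. \<Sum>w\<in>{1..n}. if {u,w} \<in> G then x u * x w else 0)"
    proof (rule sum.cong[OF refl])
      fix u assume "u \<in> {1..n}"
      have "(\<Sum>w\<in>nbhd n G u. \<Prod>z\<in>{u,w}. x z) = (\<Sum>w\<in>nbhd n G u. x u * x w)"
      proof (rule sum.cong[OF refl])
        fix w assume "w \<in> nbhd n G u"
        then have "{u, w} \<in> all_pairs n" using G unfolding nbhd_def by auto
        then show "(\<Prod>z\<in>{u,w}. x z) = x u * x w" by (simp add: pair_in_all_pairs)
      qed
      then show "(\<Sum>w\<in>nbhd n G u. \<Prod>z\<in>{u,w}. x z) = (\<Sum>w\<in>{1..n}. if {u,w} \<in> G then x u * x w else 0)"
        unfolding nbhd_def by (simp only: sum.inter_filter[OF finite_atLeastAtMost])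
    qed
    also have "\<dots> = (\<Sum>i<n. \<Sum>j<n. if {Suc i, Suc j} \<in> G then x (Suc i) * x (Suc j) else 0)"
      by (simp add: sum.atLeast1_atMost_eq)
    also have "\<dots> = (\<Sum>i<n. \<Sum>j<n. A $$ (i, j) * (\<bar>v $ i\<bar> * \<bar>v $ j\<bar>))"
      by (intro sum.cong refl) (simp add: Aij x_def)
    finally show ?thesis .
  qed
  have "k * (\<Sum>i<n. (v $ i)\<^sup>2) = (\<Sum>i<n. \<Sum>j<n. A $$ (i, j) * (v $ i * v $ j))"
  proof -
    have "k * (\<Sum>i<n. (v $ i)\<^sup>2) = (\<Sum>i<n. v $ i * (k * v $ i))"
      by (simp add: sum_distrib_left power2_eq_square mult_ac)
    also have "\<dots> = (\<Sum>i<n. v $ i * (\<Sum>j<n. A $$ (i, j) * v $ j))"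
      by (intro sum.cong refl) (simp add: ev)
    also have "\<dots> = (\<Sum>i<n. \<Sum>j<n. A $$ (i, j) * (v $ i * v $ j))"
      by (simp add: sum_distrib_left mult_ac)
    finally show ?thesis .
  qed
  also have "\<dots> \<le> (\<Sum>i<n. \<Sum>j<n. A $$ (i, j) * (\<bar>v $ i\<bar> * \<bar>v $ j\<bar>))"
  proof (intro sum_mono mult_left_mono)
    fix i j
    show "v $ i * v $ j \<le> \<bar>v $ i\<bar> * \<bar>v $ j\<bar>" by (metis abs_ge_self abs_mult)
    assume "i \<in> {..<n}" "j \<in> {..<n}"
    then show "0 \<le> A $$ (i, j)" by (simp add: Aij)
  qed
  finally have "k * (\<Sum>i<n. (v $ i)\<^sup>2) \<le> 2 * (\<Sum>e\<in>G. \<Prod>u\<in>e. x u)" unfolding form .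
  moreover have "b * (\<Sum>i<n. (v $ i)\<^sup>2) \<le> k * (\<Sum>i<n. (v $ i)\<^sup>2)"
    using k(2) by (intro mult_right_mono sum_nonneg) auto
  moreover obtain l where l: "l < n" "v $ l \<noteq> 0"
    using v(1,2) by (metis carrier_vecD eq_vecI index_zero_vec)
  moreover have "\<exists>u\<in>{1..n}. x u \<noteq> 0"
    using l by (intro bexI[of _ "Suc l"]) (auto simp: x_def)
  ultimately have "spectral_certificate n b G x"
    unfolding spectral_certificate_def norm by (auto simp: x_def)
  then show ?thesis by blast
qed

section \<open>Isomorphism with \<open>A_graph\<close>\<close>

lemma bij_betw_extending:
  fixes K L :: "nat set"
  assumes "K \<subseteq> {1..n}" "L \<subseteq> {1..n}" "card K = card L"
  obtains f where "bij_betw f {1..n} {1..n}" "\<And>u. u \<in> {1..n} \<Longrightarrow> f u \<in> L \<longleftrightarrow> u \<in> K"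
proof -
  have fin: "finite K" "finite L" using assms finite_subset by blast+
  obtain g where g: "bij_betw g K L" using finite_same_card_bij[OF fin assms(3)] by blast
  have "card ({1..n} - K) = card ({1..n} - L)" using assms fin by (simp add: card_Diff_subset)
  then obtain h where h: "bij_betw h ({1..n} - K) ({1..n} - L)"
    using finite_same_card_bij[of "{1..n} - K" "{1..n} - L"] by auto
  define f where "f u = (if u \<in> K then g u else h u)" for u
  have fK: "bij_betw f K L" using g by (subst bij_betw_cong[of K f g]) (auto simp: f_def)
  have fR: "bij_betw f ({1..n} - K) ({1..n} - L)"
    using h by (subst bij_betw_cong[of _ f h]) (auto simp: f_def)
  have "bij_betw f (K \<union> ({1..n} - K)) (L \<union> ({1..n} - L))"
    by (rule bij_betw_combine[OF fK fR]) blast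
  moreover have "K \<union> ({1..n} - K) = {1..n}" "L \<union> ({1..n} - L) = {1..n}" using assms by blast+
  ultimately have "bij_betw f {1..n} {1..n}" by simp
  moreover have "f u \<in> L \<longleftrightarrow> u \<in> K" if "u \<in> {1..n}" for u
    using bij_betwE[OF fK] bij_betwE[OF fR] that by blast
  ultimately show ?thesis by (rule that)
qed

lemma clique_isomorphic_A_graph:
  assumes "K \<subseteq> {1..n}" "card K = 2 * m + 1" "2 * m + 2 \<le> n"
  shows "graph_isomorphic n (join_graph n {} K) (A_graph 1 n m)"
proof -
  obtain f where f: "bij_betw f {1..n} {1..n}"
    and fK: "\<And>u. u \<in> {1..n} \<Longrightarrow> f u \<in> {1..2 * m + 1} \<longleftrightarrow> u \<in> K"
    using bij_betw_extending[of K n "{1..2 * m + 1}"] assms by auto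
  have A: "A_graph 1 n m = join_graph n {} {1..2 * m + 1}"
    unfolding A_graph_def join_graph_def by simp
  have "{u, v} \<in> join_graph n {} K \<longleftrightarrow> {f u, f v} \<in> A_graph 1 n m" if uv: "u \<in> {1..n}" "v \<in> {1..n}" for u v
  proof -
    have "f u \<in> {1..n}" "f v \<in> {1..n}" "f u = f v \<longleftrightarrow> u = v"
      using f uv by (auto simp: bij_betw_def inj_on_eq_iff)
    then show ?thesis unfolding A pair_in_join_graph fK[OF uv(1)] fK[OF uv(2)] using uv by simp
  qed
  then show ?thesis unfolding graph_isomorphic_def using f by blast
qed

lemma star_isomorphic_A_graph:
  assumes "C \<subseteq> {1..n}" "card C = m" "m \<le> n"
  shows "graph_isomorphic n (join_graph n C {}) (A_graph (m + 1) n m)"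
proof -
  obtain f where f: "bij_betw f {1..n} {1..n}"
    and fC: "\<And>u. u \<in> {1..n} \<Longrightarrow> f u \<in> {1..m} \<longleftrightarrow> u \<in> C"
    using bij_betw_extending[of C n "{1..m}"] assms by auto
  \<comment> \<open>The second part of this graph is a single vertex and yields no edge, which
    matches the empty \<open>K\<close> on the other side.\<close>
  have "{1..2 * m + 2 - (m + 1)} - {1..m + 1 - 1} = {m + 1}" by auto
  then have A: "A_graph (m + 1) n m = join_graph n {1..m} {m + 1}"
    unfolding A_graph_def join_graph_def by simp
  have "{u, v} \<in> join_graph n C {} \<longleftrightarrow> {f u, f v} \<in> A_graph (m + 1) n m" if uv: "u \<in> {1..n}" "v \<in> {1..n}" for u v
  proof -
    have "f u \<in> {1..n}" "f v \<in> {1..n}" "f u = f v \<longleftrightarrow> u = v"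
      using f uv by (auto simp: bij_betw_def inj_on_eq_iff)
    then show ?thesis unfolding A pair_in_join_graph fC[OF uv(1)] fC[OF uv(2)] using uv by auto
  qed
  then show ?thesis unfolding graph_isomorphic_def using f by blast
qed

text \<open>With \<open>r\<close> the larger root, the difference of the two sides factors as
  \<open>(b - r) * (b + r - (m - 1))\<close>. The second factor is at least
  \<open>2 * r - (m - 1)\<close>, the square root of the discriminant.\<close>

lemma quadratic_bound_above_root:
  fixes m c b :: real
  assumes "0 \<le> c" "(m - 1 + sqrt ((m - 1)\<^sup>2 + 4 * c)) / 2 \<le> b"
  shows "(m - 1) * b + c \<le> b\<^sup>2"
proof -
  define D where "D = (m - 1)\<^sup>2 + 4 * c"
  define r where "r = (m - 1 + sqrt D) / 2"
  have D: "0 \<le> D" unfolding D_def using assms(1) by simp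
  have rD: "2 * r - (m - 1) = sqrt D" unfolding r_def by (simp add: field_simps)
  then have "(2 * r - (m - 1))\<^sup>2 = D" using D by simp
  then have r: "r\<^sup>2 = (m - 1) * r + c" unfolding D_def by (simp add: power2_eq_square algebra_simps)
  have "r \<le> b" using assms(2) unfolding r_def D_def .
  moreover have "0 \<le> 2 * r - (m - 1)" unfolding rD using D by simp
  ultimately have "0 \<le> (b - r) * (b + r - (m - 1))" by (intro mult_nonneg_nonneg) auto
  also have "\<dots> = b\<^sup>2 - (m - 1) * b - (r\<^sup>2 - (m - 1) * r)" by (simp add: power2_eq_square algebra_simps)
  finally show ?thesis using r by simp
qed

theorem theorem3:
  fixes n m :: nat and G :: "nat \<Rightarrow> nat set set"
  assumes "m > 0" and "n \<ge> 2 * m + 2"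
    and "\<And>i. i \<in> {1..m + 1} \<Longrightarrow> graph_on n (G i)"
    and "\<And>i. i \<in> {1..m + 1} \<Longrightarrow>
      graph_spectral_radius n (G i) \<ge>
        max (2 * real m)
          ((real m - 1 + sqrt ((real m - 1)\<^sup>2 + 4 * real m * (real n - real m))) / 2)"
  shows "(n < 3 * m + 2 \<longrightarrow>
           \<not> all_equal_iso n (m + 1) G (A_graph 1 n m) \<longrightarrow>
           has_rainbow_matching (m + 1) G) \<and>
         (n = 3 * m + 2 \<longrightarrow>
           \<not> (all_equal_iso n (m + 1) G (A_graph (m + 1) n m) \<or>
              all_equal_iso n (m + 1) G (A_graph 1 n m)) \<longrightarrow>
           has_rainbow_matching (m + 1) G) \<and>
         (n > 3 * m + 2 \<longrightarrow>
           \<not> all_equal_iso n (m + 1) G (A_graph (m + 1) n m) \<longrightarrow>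
           has_rainbow_matching (m + 1) G)"
proof -
  define b where "b = max (2 * real m)
    ((real m - 1 + sqrt ((real m - 1)\<^sup>2 + 4 * real m * (real n - real m))) / 2)"
  have sq: "(real m - 1) * b + real m * (real n - real m) \<le> b\<^sup>2"
    by (rule quadratic_bound_above_root) (use assms(2) in \<open>auto simp: b_def mult.assoc\<close>)
  interpret threshold n m b
    by unfold_locales (use assms(1,2) sq in \<open>auto simp: b_def\<close>)
  have graphs: "G i \<subseteq> all_pairs n" if "i \<in> {1..m + 1}" for i
    using assms(3)[OF that] unfolding graph_on_def .
  have certs: "\<exists>x. spectral_certificate n b (G i) x" if "i \<in> {1..m + 1}" for i
    using spectral_certificate_exists[OF graphs[OF that]] assms(2) assms(4)[OF that, folded b_def] by simp
  have one: "1 \<in> {1..m + 1}" by simp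
  have clique: "n \<le> 3 * m + 2 \<and> all_equal_iso n (m + 1) G (A_graph 1 n m)" if "all_clique G"
  proof -
    obtain K where b: "b = 2 * real m" and K: "K \<subseteq> {1..n}" "card K = 2 * m + 1"
      and GK: "\<forall>i\<in>{1..m + 1}. G i = join_graph n {} K"
      using \<open>all_clique G\<close> unfolding all_clique_def by blast
    \<comment> \<open>With \<open>b = 2 * real m\<close> the quadratic inequality becomes linear in
      \<open>n\<close>.\<close>
    have "real m * real n \<le> real m * (3 * real m + 2)"
      using sq unfolding b by (simp add: power2_eq_square algebra_simps)
    then have "real n \<le> 3 * real m + 2" using m_pos by (simp only: mult_le_cancel_left_pos of_nat_0_less_iff)
    then have "n \<le> 3 * m + 2" by linarith
    moreover have "\<forall>i\<in>{1..m + 1}. G i = G 1" using GK one by metis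
    moreover have "graph_isomorphic n (G 1) (A_graph 1 n m)"
      using clique_isomorphic_A_graph[OF K n_ge] bspec[OF GK one] by metis
    ultimately show ?thesis unfolding all_equal_iso_def by blast
  qed
  have star: "3 * m + 2 \<le> n \<and> all_equal_iso n (m + 1) G (A_graph (m + 1) n m)" if "all_star G"
  proof -
    obtain C where tight: tight_star and C: "C \<subseteq> {1..n}" "card C = m"
      and GC: "\<forall>i\<in>{1..m + 1}. G i = join_graph n C {}"
      using \<open>all_star G\<close> unfolding all_star_def by blast
    \<comment> \<open>Conversely, \<open>2 * real m \<le> b\<close> bounds from below the product
      that tightness equates with \<open>real m * (real n - real m)\<close>.\<close>
    have "2 * real m * (real m + 1) \<le> b * (b - (real m - 1))"
      using b_ge by (intro mult_mono) auto
    also have "\<dots> = real m * (real n - real m)" using tight by (simp add: power2_eq_square algebra_simps)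
    finally have "real m * (2 * (real m + 1)) \<le> real m * (real n - real m)" by (simp add: mult_ac)
    then have "2 * (real m + 1) \<le> real n - real m"
      using m_pos by (simp only: mult_le_cancel_left_pos of_nat_0_less_iff)
    then have "real (3 * m + 2) \<le> real n" by simp
    then have "3 * m + 2 \<le> n" by (simp only: of_nat_le_iff)
    moreover have "\<forall>i\<in>{1..m + 1}. G i = G 1" using GC one by metis
    moreover have "graph_isomorphic n (G 1) (A_graph (m + 1) n m)"
      using star_isomorphic_A_graph[OF C] n_ge bspec[OF GC one] by simp
    ultimately show ?thesis unfolding all_equal_iso_def by blast
  qed
  \<comment> \<open>The clique case forces \<open>n \<le> 3 * m + 2\<close> and the star case
    \<open>3 * m + 2 \<le> n\<close>, so both survive only at \<open>n = 3 * m + 2\<close>.\<close>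
  have "has_rainbow_matching (m + 1) G \<or> all_clique G \<or> all_star G"
    using no_rainbow_structure[of G] graphs certs by blast
  then show ?thesis using clique star by (elim disjE) auto
qed

end
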